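(* Let $\alpha,\beta,\gamma,\delta\in\mathbb{R}$ with $\alpha+\delta\neq 0$ and $\alpha\gamma-\beta\delta=0$. Let $G_6$ be the connected, simply connected three-dimensional Lie group with left-invariant Lorentzian metric $g$ whose Lie algebra has a pseudo-orthonormal basis $\{e_1,e_2,e_3\}$, $e_3$ timelike, with $$[e_1,e_2]=\alpha e_2+\beta e_3,\quad [e_1,e_3]=\gamma e_2+\delta e_3,\quad [e_2,e_3]=0.$$ Let $V=\lambda_1e_1+\lambda_2e_2+\lambda_3e_3$ with $\lambda_1,\lambda_2,\lambda_3\in\mathbb{R}$, and let $\lambda\in\mathbb{R}$. Then $(G_6,V,g)$ is a left-invariant Riemann soliton with constant $\lambda$ if and only if one of the following holds (parameters not mentioned in a case are unrestricted): (i) $\beta\neq\gamma$, $\lambda_1=0$, $\alpha=\beta=0$, $\lambda=\frac{\gamma^2}{4}$, $\lambda_3=0$, $\delta^2=\gamma^2$; (ii) $\beta\neq\gamma$, $\lambda_1=0$, $\alpha\neq 0$, $\alpha^2=\beta^2$, $\delta=\frac{\beta\gamma}{\alpha}$, $\lambda=\frac{(\beta+\gamma)^2}{4}$, $\lambda_2=-\frac{\gamma}{\alpha}\lambda_3$; (iii) $\beta=\gamma$, $\beta\neq 0$, $\alpha=\delta$, $\alpha\neq 0$, $\lambda_1=\lambda_2=\lambda_3=0$, $\lambda=\alpha^2$; (iv) $\lambda_3\neq 0$, $\lambda_2=-\frac{\delta}{\beta}\lambda_3$, $\alpha\neq 0$, $\beta\neq 0$, $\beta=\gamma$, $\alpha=\delta$,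 $\alpha^2=\beta^2$, $\lambda_1=0$, $\lambda=\alpha^2$; (v) $\beta=\gamma=0$, $\alpha\neq 0$, $\delta\neq 0$, $\lambda_1=\lambda_2=\lambda_3=0$, $\alpha=\delta$, $\lambda=\alpha^2$.
   Context: Elements of the Lie algebra are identified with left-invariant vector fields. A pseudo-orthonormal basis $\{e_1,e_2,e_3\}$ with $e_3$ timelike means $g(e_1,e_1)=g(e_2,e_2)=1$, $g(e_3,e_3)=-1$, and $g(e_i,e_j)=0$ for $i\ne j$. Let $\nabla$ be the Levi-Civita connection of $g$, with curvature $R(X,Y)Z=\nabla_X\nabla_YZ-\nabla_Y\nabla_XZ-\nabla_{[X,Y]}Z$, and set $R(X,Y,Z,W)=-g(R(X,Y)Z,W)$. For $(0,2)$-tensors $T_1,T_2$ the Kulkarni-Nomizu product is $$(T_1\wedge T_2)(X,Y,Z,W)=T_1(X,W)T_2(Y,Z)+T_1(Y,Z)T_2(X,W)-T_1(X,Z)T_2(Y,W)-T_1(Y,W)T_2(X,Z).$$ $L_Vg$ denotes the Lie derivative of $g$ along $V$. For a left-invariant vector field $V$ and a real constant $\lambda$, $(G,V,g)$ is a left-invariant Riemann soliton with constant $\lambda$ if $R+\frac12 L_Vg\wedge g=\frac{\lambda}{2}g\wedge g$, i.e. for all vector fields $X,Y,Z,W$, $$2R(X,Y,Z,W)+g(X,W)(L_Vg)(Y,Z)+g(Y,Z)(L_Vg)(X,W)-g(X,Z)(L_Vg)(Y,W)-g(Y,W)(L_Vg)(X,Z)=2\lambda[g(X,W)g(Y,Z)-g(X,Z)g(Y,W)].$$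 *)

theory Defs
  imports "HOL-Analysis.Analysis" "HOL-Library.Function_Algebras"
begin

section \<open>Smooth manifolds\<close>

text \<open>\<open>C_diff k S f\<close>: \<open>f\<close> is \<open>k\<close> times continuously differentiable on \<open>S\<close>. It is only ever used
  for open \<open>S\<close>, where the derivatives do not depend on values of \<open>f\<close> outside \<open>S\<close>.\<close>

primrec C_diff :: "nat \<Rightarrow> 'a::euclidean_space set \<Rightarrow> ('a \<Rightarrow> 'b::real_normed_vector) \<Rightarrow> bool" where
  "C_diff 0 S f \<longleftrightarrow> continuous_on S f"
| "C_diff (Suc k) S f \<longleftrightarrow> (\<forall>x\<in>S. f differentiable (at x)) \<and>
     (\<forall>b\<in>Basis. C_diff k S (\<lambda>x. frechet_derivative f (at x) b))"

definition smooth_on :: "'a::euclidean_space set \<Rightarrow> ('a \<Rightarrow> 'b::real_normed_vector) \<Rightarrow> bool" where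
  "smooth_on S f \<longleftrightarrow> (\<forall>k. C_diff k S f)"

text \<open>A chart is a pair of its domain and its coordinate map; the values of the coordinate map
  outside the domain are irrelevant. The manifold is the whole type \<open>'m\<close>.\<close>

type_synonym ('m, 'e) chart = "'m set \<times> ('m \<Rightarrow> 'e)"
type_synonym ('m, 'e) atlas = "('m, 'e) chart set"

definition smooth_atlas :: "('m::topological_space, 'e::euclidean_space) atlas \<Rightarrow> bool" where
  "smooth_atlas A \<longleftrightarrow>
     (\<Union>(U, \<phi>)\<in>A. U) = UNIV \<and>
     (\<forall>(U, \<phi>)\<in>A. open U \<and> open (\<phi> ` U) \<and> homeomorphism U (\<phi> ` U) \<phi> (inv_into U \<phi>)) \<and>
     (\<forall>(U, \<phi>)\<in>A. \<forall>(V, \<psi>)\<in>A. smooth_on (\<phi> ` (U \<inter> V)) (\<psi> \<circ> inv_into U \<phi>))"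

definition prod_atlas ::
  "('m, 'e) atlas \<Rightarrow> ('n, 'f) atlas \<Rightarrow> ('m \<times> 'n, 'e \<times> 'f) atlas" where
  "prod_atlas A B = {(U \<times> V, map_prod \<phi> \<psi>) | U \<phi> V \<psi>. (U, \<phi>) \<in> A \<and> (V, \<psi>) \<in> B}"

definition smooth_map :: "('m::topological_space, 'e::euclidean_space) atlas \<Rightarrow>
    ('n::topological_space, 'f::euclidean_space) atlas \<Rightarrow> ('m \<Rightarrow> 'n) \<Rightarrow> bool" where
  "smooth_map A B h \<longleftrightarrow> continuous_on UNIV h \<and>
     (\<forall>(U, \<phi>)\<in>A. \<forall>(V, \<psi>)\<in>B. smooth_on (\<phi> ` (U \<inter> h -` V)) (\<psi> \<circ> h \<circ> inv_into U \<phi>))"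

definition smooth_fun ::
  "('m::topological_space, 'e::euclidean_space) atlas \<Rightarrow> 'm set \<Rightarrow> ('m \<Rightarrow> real) \<Rightarrow> bool" where
  "smooth_fun A W f \<longleftrightarrow> open W \<and> (\<forall>(U, \<phi>)\<in>A. smooth_on (\<phi> ` (U \<inter> W)) (f \<circ> inv_into U \<phi>))"

definition smooth_near ::
  "('m::topological_space, 'e::euclidean_space) atlas \<Rightarrow> 'm \<Rightarrow> ('m \<Rightarrow> real) \<Rightarrow> bool" where
  "smooth_near A p f \<longleftrightarrow> (\<exists>W. p \<in> W \<and> smooth_fun A W f)"


section \<open>Tangent vectors and vector fields\<close>

text \<open>Tangent vectors at \<open>p\<close> act on functions that are smooth near \<open>p\<close> as directional derivatives in
  a chart. By convention they vanish on all other functions, so that HOL equality of tangent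
  vectors is the intended equality. Sums and differences of tangent vectors, vector fields and
  functions are the pointwise ones of \<^theory>\<open>HOL-Library.Function_Algebras\<close>.\<close>

type_synonym 'm tangent = "('m \<Rightarrow> real) \<Rightarrow> real"
type_synonym 'm vfield = "'m \<Rightarrow> 'm tangent"

definition tangent_space ::
  "('m::topological_space, 'e::euclidean_space) atlas \<Rightarrow> 'm \<Rightarrow> 'm tangent set" where
  "tangent_space A p =
     {\<lambda>f. if smooth_near A p f then frechet_derivative (f \<circ> inv_into U \<phi>) (at (\<phi> p)) v else 0
      | U \<phi> v. (U, \<phi>) \<in> A \<and> p \<in> U}"

definition differential :: "('m::topological_space, 'e::euclidean_space) atlas \<Rightarrow>
    ('m \<Rightarrow> 'm) \<Rightarrow> 'm \<Rightarrow> 'm tangent \<Rightarrow> 'm tangent" where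
  "differential A h p u = (\<lambda>f. if smooth_near A (h p) f then u (f \<circ> h) else 0)"

definition vector_field ::
  "('m::topological_space, 'e::euclidean_space) atlas \<Rightarrow> 'm vfield \<Rightarrow> bool" where
  "vector_field A X \<longleftrightarrow> (\<forall>p. X p \<in> tangent_space A p) \<and>
     (\<forall>W f. smooth_fun A W f \<longrightarrow> smooth_fun A W (\<lambda>p. X p f))"

definition deriv_along :: "'m vfield \<Rightarrow> ('m \<Rightarrow> real) \<Rightarrow> 'm \<Rightarrow> real" where
  "deriv_along X f = (\<lambda>p. X p f)"

definition scale_field :: "('m \<Rightarrow> real) \<Rightarrow> 'm vfield \<Rightarrow> 'm vfield" (infixr \<open>\<odot>\<close> 75) where
  "f \<odot> X = (\<lambda>p h. f p * X p h)"

abbreviation scale_const :: "real \<Rightarrow> 'm vfield \<Rightarrow> 'm vfield" (infixr \<open>*\<^sub>V\<close> 75) where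
  "c *\<^sub>V X \<equiv> (\<lambda>_. c) \<odot> X"

definition lie_bracket :: "('m::topological_space, 'e::euclidean_space) atlas \<Rightarrow>
    'm vfield \<Rightarrow> 'm vfield \<Rightarrow> 'm vfield" where
  "lie_bracket A X Y = (\<lambda>p f. if smooth_near A p f
     then X p (deriv_along Y f) - Y p (deriv_along X f) else 0)"


section \<open>Lorentzian metrics, Levi-Civita connection, curvature\<close>

type_synonym 'm metric = "'m \<Rightarrow> 'm tangent \<Rightarrow> 'm tangent \<Rightarrow> real"
type_synonym 'm connection = "'m vfield \<Rightarrow> 'm vfield \<Rightarrow> 'm vfield"
type_synonym 'm tensor2 = "'m vfield \<Rightarrow> 'm vfield \<Rightarrow> 'm \<Rightarrow> real"
type_synonym 'm tensor4 = "'m vfield \<Rightarrow> 'm vfield \<Rightarrow> 'm vfield \<Rightarrow> 'm vfield \<Rightarrow> 'm \<Rightarrow> real"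

definition metric_tensor :: "'m metric \<Rightarrow> 'm tensor2" where
  "metric_tensor g X Y = (\<lambda>p. g p (X p) (Y p))"

text \<open>The last clause says that each \<open>g p\<close> has signature \<open>(n - 1, 1)\<close>: there is a timelike vector
  on whose orthogonal complement \<open>g p\<close> is positive definite. In particular \<open>g p\<close> is nondegenerate.\<close>

definition lorentzian_metric ::
  "('m::topological_space, 'e::euclidean_space) atlas \<Rightarrow> 'm metric \<Rightarrow> bool" where
  "lorentzian_metric A g \<longleftrightarrow>
     (\<forall>p. \<forall>u\<in>tangent_space A p. \<forall>v\<in>tangent_space A p. g p u v = g p v u) \<and>
     (\<forall>p. \<forall>u\<in>tangent_space A p. \<forall>v\<in>tangent_space A p. \<forall>w\<in>tangent_space A p.
        g p (u + v) w = g p u w + g p v w) \<and>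
     (\<forall>p. \<forall>u\<in>tangent_space A p. \<forall>v\<in>tangent_space A p. \<forall>c.
        g p (\<lambda>f. c * u f) v = c * g p u v) \<and>
     (\<forall>X Y. vector_field A X \<longrightarrow> vector_field A Y \<longrightarrow> smooth_fun A UNIV (metric_tensor g X Y)) \<and>
     (\<forall>p. \<exists>t\<in>tangent_space A p. g p t t < 0 \<and>
        (\<forall>u\<in>tangent_space A p. g p t u = 0 \<and> u \<noteq> 0 \<longrightarrow> g p u u > 0))"

definition affine_connection ::
  "('m::topological_space, 'e::euclidean_space) atlas \<Rightarrow> 'm connection \<Rightarrow> bool" where
  "affine_connection A D \<longleftrightarrow>
     (\<forall>X Y. vector_field A X \<longrightarrow> vector_field A Y \<longrightarrow> vector_field A (D X Y)) \<and>
     (\<forall>X Y Z. vector_field A X \<longrightarrow> vector_field A Y \<longrightarrow> vector_field A Z \<longrightarrow>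
        D (X + Y) Z = D X Z + D Y Z \<and> D X (Y + Z) = D X Y + D X Z) \<and>
     (\<forall>f X Y. smooth_fun A UNIV f \<longrightarrow> vector_field A X \<longrightarrow> vector_field A Y \<longrightarrow>
        D (f \<odot> X) Y = f \<odot> D X Y \<and> D X (f \<odot> Y) = deriv_along X f \<odot> Y + f \<odot> D X Y)"

definition levi_civita ::
  "('m::topological_space, 'e::euclidean_space) atlas \<Rightarrow> 'm metric \<Rightarrow> 'm connection \<Rightarrow> bool" where
  "levi_civita A g D \<longleftrightarrow> affine_connection A D \<and>
     (\<forall>X Y. vector_field A X \<longrightarrow> vector_field A Y \<longrightarrow> D X Y - D Y X = lie_bracket A X Y) \<and>
     (\<forall>X Y Z. vector_field A X \<longrightarrow> vector_field A Y \<longrightarrow> vector_field A Z \<longrightarrow>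
        deriv_along X (metric_tensor g Y Z) =
          metric_tensor g (D X Y) Z + metric_tensor g Y (D X Z))"

definition curvature_op :: "('m::topological_space, 'e::euclidean_space) atlas \<Rightarrow>
    'm connection \<Rightarrow> 'm vfield \<Rightarrow> 'm vfield \<Rightarrow> 'm vfield \<Rightarrow> 'm vfield" where
  "curvature_op A D X Y Z = D X (D Y Z) - D Y (D X Z) - D (lie_bracket A X Y) Z"

text \<open>Sign convention: \<open>R(X, Y, Z, W) = - g(R(X, Y) Z, W)\<close>.\<close>

definition curvature_tensor :: "('m::topological_space, 'e::euclidean_space) atlas \<Rightarrow>
    'm metric \<Rightarrow> 'm connection \<Rightarrow> 'm tensor4" where
  "curvature_tensor A g D X Y Z W = (\<lambda>p. - metric_tensor g (curvature_op A D X Y Z) W p)"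

definition kulkarni_nomizu :: "'m tensor2 \<Rightarrow> 'm tensor2 \<Rightarrow> 'm tensor4" where
  "kulkarni_nomizu S T X Y Z W = (\<lambda>p.
     S X W p * T Y Z p + S Y Z p * T X W p - S X Z p * T Y W p - S Y W p * T X Z p)"

definition lie_derivative_metric :: "('m::topological_space, 'e::euclidean_space) atlas \<Rightarrow>
    'm metric \<Rightarrow> 'm vfield \<Rightarrow> 'm tensor2" where
  "lie_derivative_metric A g V X Y = (\<lambda>p.
     deriv_along V (metric_tensor g X Y) p
     - metric_tensor g (lie_bracket A V X) Y p
     - metric_tensor g X (lie_bracket A V Y) p)"


section \<open>Lie groups and left-invariant structures\<close>

definition lie_group :: "('m::{t2_space, second_countable_topology}, 'e::euclidean_space) atlas \<Rightarrow>
    ('m \<Rightarrow> 'm \<Rightarrow> 'm) \<Rightarrow> 'm \<Rightarrow> ('m \<Rightarrow> 'm) \<Rightarrow> bool" where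
  "lie_group A mul e ginv \<longleftrightarrow> smooth_atlas A \<and> Groups.group mul e ginv \<and>
     smooth_map (prod_atlas A A) A (\<lambda>(x, y). mul x y) \<and> smooth_map A A ginv"

definition left_invariant_field :: "('m::topological_space, 'e::euclidean_space) atlas \<Rightarrow>
    ('m \<Rightarrow> 'm \<Rightarrow> 'm) \<Rightarrow> 'm vfield \<Rightarrow> bool" where
  "left_invariant_field A mul X \<longleftrightarrow> vector_field A X \<and>
     (\<forall>a p. X (mul a p) = differential A (mul a) p (X p))"

definition left_invariant_metric :: "('m::topological_space, 'e::euclidean_space) atlas \<Rightarrow>
    ('m \<Rightarrow> 'm \<Rightarrow> 'm) \<Rightarrow> 'm metric \<Rightarrow> bool" where
  "left_invariant_metric A mul g \<longleftrightarrow>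
     (\<forall>a p. \<forall>u\<in>tangent_space A p. \<forall>v\<in>tangent_space A p.
        g (mul a p) (differential A (mul a) p u) (differential A (mul a) p v) = g p u v)"

definition lie_algebra_basis3 :: "('m::topological_space, 'e::euclidean_space) atlas \<Rightarrow>
    ('m \<Rightarrow> 'm \<Rightarrow> 'm) \<Rightarrow> 'm vfield \<Rightarrow> 'm vfield \<Rightarrow> 'm vfield \<Rightarrow> bool" where
  "lie_algebra_basis3 A mul e1 e2 e3 \<longleftrightarrow>
     left_invariant_field A mul e1 \<and> left_invariant_field A mul e2 \<and>
     left_invariant_field A mul e3 \<and>
     (\<forall>X. left_invariant_field A mul X \<longrightarrow>
        (\<exists>!c::real^3. X = c $ 1 *\<^sub>V e1 + c $ 2 *\<^sub>V e2 + c $ 3 *\<^sub>V e3))"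

definition pseudo_orthonormal3 ::
  "'m metric \<Rightarrow> 'm vfield \<Rightarrow> 'm vfield \<Rightarrow> 'm vfield \<Rightarrow> bool" where
  "pseudo_orthonormal3 g e1 e2 e3 \<longleftrightarrow>
     metric_tensor g e1 e1 = (\<lambda>_. 1) \<and> metric_tensor g e2 e2 = (\<lambda>_. 1) \<and>
     metric_tensor g e3 e3 = (\<lambda>_. - 1) \<and>
     metric_tensor g e1 e2 = (\<lambda>_. 0) \<and> metric_tensor g e1 e3 = (\<lambda>_. 0) \<and>
     metric_tensor g e2 e3 = (\<lambda>_. 0)"

definition left_invariant_riemann_soliton :: "('m::topological_space, 'e::euclidean_space) atlas \<Rightarrow>
    ('m \<Rightarrow> 'm \<Rightarrow> 'm) \<Rightarrow> 'm metric \<Rightarrow> 'm connection \<Rightarrow> 'm vfield \<Rightarrow> real \<Rightarrow> bool" where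
  "left_invariant_riemann_soliton A mul g D V lam \<longleftrightarrow> left_invariant_field A mul V \<and>
     (\<forall>X Y Z W p. vector_field A X \<longrightarrow> vector_field A Y \<longrightarrow> vector_field A Z \<longrightarrow> vector_field A W \<longrightarrow>
        curvature_tensor A g D X Y Z W p
        + 1/2 * kulkarni_nomizu (lie_derivative_metric A g V) (metric_tensor g) X Y Z W p
        = lam/2 * kulkarni_nomizu (metric_tensor g) (metric_tensor g) X Y Z W p)"

end

theory Submission
  imports Defs
begin

text \<open>Computing in an orthonormal frame is legitimate for two reasons: the three frame fields span each
  tangent space, because orthonormality makes them independent and the chart has dimension three;
  and both sides of the soliton equation are tensorial. For the curvature and the Lie derivative of
  the metric, tensoriality is read off from the Levi-Civita axioms, with brackets replaced by
  \<open>[X, Y] = D X Y - D Y X\<close> and \<open>(L\<^sub>V g)(X, Y) = g(D X V, Y) + g(D Y V, X)\<close>. Koszul's formula gives the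
  connection in the frame. Since \<open>\<alpha> \<gamma> = \<beta> \<delta>\<close>, the curvature operator on bivectors is diagonal
  there, so the soliton equation says that the off-diagonal components of \<open>L\<^sub>V g\<close> vanish
  and that three affine expressions in \<open>l1\<close> equal \<open>lam\<close>; the cases solve these six equations.\<close>

section \<open>Algebra of smooth functions\<close>

lemma C_diff_subset: "C_diff k S f \<Longrightarrow> T \<subseteq> S \<Longrightarrow> C_diff k T f"
  by (induction k arbitrary: f) (auto intro: continuous_on_subset)

lemma C_diff_Suc_imp: "C_diff (Suc k) S f \<Longrightarrow> C_diff k S f"
proof (induction k arbitrary: f)
  case 0
  then show ?case
    by (auto intro!: continuous_at_imp_continuous_on differentiable_imp_continuous_within)
next
  case (Suc k)
  then show ?case by (metis C_diff.simps(2))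
qed

text \<open>Every point of the open set \<open>S\<close> has a neighbourhood on which
  \<open>f\<close> and \<open>h\<close> coincide, so their derivatives coincide too. This lets a
  derivative be replaced by its sum-rule or product-rule expression.\<close>

lemma C_diff_cong:
  assumes "open S" and "\<And>x. x \<in> S \<Longrightarrow> f x = h x" and "C_diff k S f"
  shows "C_diff k S h"
  using assms(2,3)
proof (induction k arbitrary: f h)
  case 0
  then show ?case by (simp cong: continuous_on_cong)
next
  case (Suc k)
  have der: "(h has_derivative frechet_derivative f (at x)) (at x)" if "x \<in> S" for x
  proof (rule has_derivative_transform_within_open[OF _ assms(1) that Suc.prems(1)])
    show "(f has_derivative frechet_derivative f (at x)) (at x)"
      using Suc.prems(2) that by (simp flip: frechet_derivative_works)
  qed
  have "C_diff k S (\<lambda>x. frechet_derivative h (at x) b)" if "b \<in> Basis" for b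
  proof (rule Suc.IH)
    show "C_diff k S (\<lambda>x. frechet_derivative f (at x) b)"
      using Suc.prems(2) that by simp
    show "frechet_derivative f (at x) b = frechet_derivative h (at x) b" if "x \<in> S" for x
      using frechet_derivative_at[OF der[OF that]] by simp
  qed
  moreover have "h differentiable at x" if "x \<in> S" for x
    using der[OF that] by (rule differentiableI)
  ultimately show ?case by simp
qed

lemma C_diff_const: "C_diff k S (\<lambda>_. c)"
  by (induction k arbitrary: c) auto

lemma frechet_derivative_add_apply:
  assumes "f differentiable at x" "h differentiable at x"
  shows "frechet_derivative (\<lambda>x. f x + h x) (at x) v
    = frechet_derivative f (at x) v + frechet_derivative h (at x) v"
proof -
  have "((\<lambda>x. f x + h x) has_derivative
      (\<lambda>v. frechet_derivative f (at x) v + frechet_derivative h (at x) v)) (at x)"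
    using assms by (intro has_derivative_add) (simp_all add: frechet_derivative_works)
  from frechet_derivative_at[OF this] show ?thesis by (rule fun_cong[symmetric])
qed

lemma frechet_derivative_mult_apply:
  fixes f h :: "'a::real_normed_vector \<Rightarrow> real"
  assumes "f differentiable at x" "h differentiable at x"
  shows "frechet_derivative (\<lambda>x. f x * h x) (at x) v
    = f x * frechet_derivative h (at x) v + frechet_derivative f (at x) v * h x"
proof -
  have "((\<lambda>x. f x * h x) has_derivative
      (\<lambda>v. f x * frechet_derivative h (at x) v + frechet_derivative f (at x) v * h x)) (at x)"
    using assms by (intro has_derivative_mult) (simp_all add: frechet_derivative_works)
  from frechet_derivative_at[OF this] show ?thesis by (rule fun_cong[symmetric])
qed

lemma C_diff_add:
  assumes "open S" "C_diff k S f" "C_diff k S h"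
  shows "C_diff k S (\<lambda>x. f x + h x)"
  using assms(2,3)
proof (induction k arbitrary: f h)
  case 0
  then show ?case by (simp add: continuous_on_add)
next
  case (Suc k)
  have "C_diff k S (\<lambda>x. frechet_derivative (\<lambda>x. f x + h x) (at x) b)" if "b \<in> Basis" for b
  proof (rule C_diff_cong[OF assms(1)])
    show "C_diff k S (\<lambda>x. frechet_derivative f (at x) b + frechet_derivative h (at x) b)"
      using Suc that by simp
    show "frechet_derivative f (at x) b + frechet_derivative h (at x) b
        = frechet_derivative (\<lambda>x. f x + h x) (at x) b" if "x \<in> S" for x
      using Suc.prems that by (simp add: frechet_derivative_add_apply)
  qed
  moreover have "\<forall>x\<in>S. (\<lambda>x. f x + h x) differentiable at x"
    using Suc.prems by (simp add: differentiable_add)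
  ultimately show ?case by simp
qed

lemma C_diff_mult:
  fixes f h :: "'a::euclidean_space \<Rightarrow> real"
  assumes "open S" "C_diff k S f" "C_diff k S h"
  shows "C_diff k S (\<lambda>x. f x * h x)"
  using assms(2,3)
proof (induction k arbitrary: f h)
  case 0
  then show ?case by (simp add: continuous_on_mult)
next
  case (Suc k)
  \<comment> \<open>The product rule multiplies derivatives by the undifferentiated functions, so
    the induction hypothesis needs these at order \<open>k\<close> as well.\<close>
  have fh: "C_diff k S f" "C_diff k S h"
    using Suc.prems C_diff_Suc_imp by blast+
  have "C_diff k S (\<lambda>x. frechet_derivative (\<lambda>x. f x * h x) (at x) b)" if "b \<in> Basis" for b
  proof (rule C_diff_cong[OF assms(1)])
    have "C_diff k S (\<lambda>x. frechet_derivative f (at x) b)" "C_diff k S (\<lambda>x. frechet_derivative h (at x) b)"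
      using Suc.prems that by simp_all
    then show "C_diff k S (\<lambda>x. f x * frechet_derivative h (at x) b + frechet_derivative f (at x) b * h x)"
      by (intro C_diff_add[OF assms(1)] Suc.IH fh)
    show "f x * frechet_derivative h (at x) b + frechet_derivative f (at x) b * h x
        = frechet_derivative (\<lambda>x. f x * h x) (at x) b" if "x \<in> S" for x
      using Suc.prems that by (simp add: frechet_derivative_mult_apply)
  qed
  moreover have "\<forall>x\<in>S. (\<lambda>x. f x * h x) differentiable at x"
    using Suc.prems by (simp add: differentiable_mult)
  ultimately show ?case by simp
qed

lemma smooth_on_differentiable:
  "smooth_on S f \<Longrightarrow> x \<in> S \<Longrightarrow> f differentiable at x"
  unfolding smooth_on_def using C_diff.simps(2)[of 0 S f] by blast

section \<open>Charts and smooth functions on a manifold\<close>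

locale smooth_manifold =
  fixes A :: "('m::topological_space, 'e::euclidean_space) atlas"
  assumes smooth_atlas: "smooth_atlas A"
begin

lemma chart:
  assumes "(U, \<phi>) \<in> A"
  shows chart_open: "open U" and chart_range_open: "open (\<phi> ` U)"
    and chart_homeomorphism: "homeomorphism U (\<phi> ` U) \<phi> (inv_into U \<phi>)"
  using smooth_atlas assms unfolding smooth_atlas_def by auto

lemma chart_change_smooth:
  "(U, \<phi>) \<in> A \<Longrightarrow> (V, \<psi>) \<in> A \<Longrightarrow> smooth_on (\<phi> ` (U \<inter> V)) (\<psi> \<circ> inv_into U \<phi>)"
  using smooth_atlas unfolding smooth_atlas_def by auto

lemma chart_cover: obtains U \<phi> where "(U, \<phi>) \<in> A" "p \<in> U"
proof -
  have "p \<in> (\<Union>(U, \<phi>)\<in>A. U)"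
    using smooth_atlas unfolding smooth_atlas_def by simp
  then show ?thesis using that by auto
qed

lemma chart_inv: "(U, \<phi>) \<in> A \<Longrightarrow> q \<in> U \<Longrightarrow> inv_into U \<phi> (\<phi> q) = q"
  using homeomorphism_apply1[OF chart_homeomorphism] .

text \<open>A chart is an open map onto its range, and the range is open in the coordinate space.
  This supplies the openness that sums and products of \<open>C_diff\<close> functions ask
  for.\<close>

lemma chart_image_open:
  assumes "(U, \<phi>) \<in> A" "open W"
  shows "open (\<phi> ` (U \<inter> W))"
proof -
  have "openin (top_of_set U) (U \<inter> W)"
    using assms(2) by auto
  then have "openin (top_of_set (\<phi> ` U)) (\<phi> ` (U \<inter> W))"
    by (rule homeomorphism_imp_open_map[OF chart_homeomorphism[OF assms(1)]])
  then show ?thesis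
    using openin_open_trans chart_range_open[OF assms(1)] by blast
qed

lemma smooth_fun_subset:
  "smooth_fun A W f \<Longrightarrow> open W' \<Longrightarrow> W' \<subseteq> W \<Longrightarrow> smooth_fun A W' f"
  unfolding smooth_fun_def smooth_on_def
  by (blast intro: C_diff_subset)

lemma smooth_fun_iff:
  "smooth_fun A W f \<longleftrightarrow> open W \<and>
    (\<forall>U \<phi> k. (U, \<phi>) \<in> A \<longrightarrow> C_diff k (\<phi> ` (U \<inter> W)) (\<lambda>x. f (inv_into U \<phi> x)))"
  unfolding smooth_fun_def smooth_on_def comp_def by blast

lemma smooth_fun_const: "open W \<Longrightarrow> smooth_fun A W (\<lambda>_. c)"
  by (auto simp: smooth_fun_def smooth_on_def comp_def C_diff_const)

lemma smooth_fun_add: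
  "smooth_fun A W f \<Longrightarrow> smooth_fun A W h \<Longrightarrow> smooth_fun A W (\<lambda>p. f p + h p)"
  unfolding smooth_fun_iff using C_diff_add[OF chart_image_open] by metis

lemma smooth_fun_mult:
  "smooth_fun A W f \<Longrightarrow> smooth_fun A W h \<Longrightarrow> smooth_fun A W (\<lambda>p. f p * h p)"
  unfolding smooth_fun_iff using C_diff_mult[OF chart_image_open] by metis

lemma smooth_nearI: "smooth_fun A W f \<Longrightarrow> p \<in> W \<Longrightarrow> smooth_near A p f"
  unfolding smooth_near_def by blast

lemma smooth_near_differentiable:
  assumes "smooth_near A p f" "(U, \<phi>) \<in> A" "p \<in> U"
  shows "(f \<circ> inv_into U \<phi>) differentiable at (\<phi> p)"
proof -
  obtain W where "p \<in> W" "smooth_fun A W f"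
    using assms(1) unfolding smooth_near_def by blast
  then have "smooth_on (\<phi> ` (U \<inter> W)) (f \<circ> inv_into U \<phi>)" "\<phi> p \<in> \<phi> ` (U \<inter> W)"
    using assms(2,3) unfolding smooth_fun_def by auto
  then show ?thesis by (rule smooth_on_differentiable)
qed


section \<open>The tangent space\<close>

text \<open>Naming the members of \<open>tangent_space\<close> by their coordinate vectors makes
  linear algebra in the coordinate space available.\<close>

definition chart_tangent :: "'m set \<Rightarrow> ('m \<Rightarrow> 'e) \<Rightarrow> 'm \<Rightarrow> 'e \<Rightarrow> 'm tangent" where
  "chart_tangent U \<phi> p v = (\<lambda>f. if smooth_near A p f
     then frechet_derivative (f \<circ> inv_into U \<phi>) (at (\<phi> p)) v else 0)"

lemma tangent_space_alt:
  "tangent_space A p = {chart_tangent U \<phi> p v | U \<phi> v. (U, \<phi>) \<in> A \<and> p \<in> U}"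
  unfolding tangent_space_def chart_tangent_def ..

text \<open>By the chain rule, coordinate vectors transform with the derivative of the change of
  charts.\<close>

lemma chart_tangent_change:
  assumes "(U, \<phi>) \<in> A" "(V, \<psi>) \<in> A" "p \<in> U" "p \<in> V"
  shows "chart_tangent V \<psi> p v
    = chart_tangent U \<phi> p (frechet_derivative (\<phi> \<circ> inv_into V \<psi>) (at (\<psi> p)) v)"
proof
  fix f
  show "chart_tangent V \<psi> p v f
    = chart_tangent U \<phi> p (frechet_derivative (\<phi> \<circ> inv_into V \<psi>) (at (\<psi> p)) v) f"
  proof (cases "smooth_near A p f")
    case True
    let ?k = "\<phi> \<circ> inv_into V \<psi>"
    have "smooth_on (\<psi> ` (V \<inter> U)) ?k"
      using assms(1,2) by (intro chart_change_smooth)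
    then have k: "(?k has_derivative frechet_derivative ?k (at (\<psi> p))) (at (\<psi> p))"
      using assms(3,4) smooth_on_differentiable frechet_derivative_works by blast
    have kp: "?k (\<psi> p) = \<phi> p"
      using chart_inv[OF assms(2,4)] by simp
    have "(f \<circ> inv_into U \<phi> has_derivative frechet_derivative (f \<circ> inv_into U \<phi>) (at (?k (\<psi> p))))
        (at (?k (\<psi> p)))"
      using smooth_near_differentiable[OF True assms(1,3)] kp frechet_derivative_works by metis
    from diff_chain_at[OF k this]
    have "((f \<circ> inv_into U \<phi>) \<circ> ?k has_derivative
        frechet_derivative (f \<circ> inv_into U \<phi>) (at (\<phi> p)) \<circ> frechet_derivative ?k (at (\<psi> p)))
        (at (\<psi> p))"
      unfolding kp .
    \<comment> \<open>The factorization through the change of charts holds only over the overlap of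
      the two domains, whose image is an open neighbourhood of \<open>\<psi> p\<close>.\<close>
    then have "(f \<circ> inv_into V \<psi> has_derivative
        frechet_derivative (f \<circ> inv_into U \<phi>) (at (\<phi> p)) \<circ> frechet_derivative ?k (at (\<psi> p)))
        (at (\<psi> p))"
    proof (rule has_derivative_transform_within_open)
      show "open (\<psi> ` (V \<inter> U))"
        using chart_image_open[OF assms(2) chart_open[OF assms(1)]] .
      show "\<psi> p \<in> \<psi> ` (V \<inter> U)"
        using assms by blast
      show "((f \<circ> inv_into U \<phi>) \<circ> ?k) x = (f \<circ> inv_into V \<psi>) x" if "x \<in> \<psi> ` (V \<inter> U)" for x
        using that chart_inv assms(1,2) by auto
    qed
    from frechet_derivative_at[OF this, symmetric] True show ?thesis
      by (simp add: chart_tangent_def)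
  qed (simp add: chart_tangent_def)
qed

text \<open>In \<open>tangent_space\<close> the chart may vary with the vector. With one chart for
  all vectors at \<open>p\<close>, sums can be formed on coordinates.\<close>

lemma tangent_space_chart:
  assumes "(U, \<phi>) \<in> A" "p \<in> U"
  shows "tangent_space A p = range (chart_tangent U \<phi> p)"
proof (intro equalityI subsetI)
  fix u assume "u \<in> tangent_space A p"
  then obtain V \<psi> v where "(V, \<psi>) \<in> A" "p \<in> V" "u = chart_tangent V \<psi> p v"
    unfolding tangent_space_alt by blast
  then show "u \<in> range (chart_tangent U \<phi> p)"
    using chart_tangent_change[of U \<phi> V \<psi>] assms by blast
next
  fix u assume "u \<in> range (chart_tangent U \<phi> p)"
  then show "u \<in> tangent_space A p"
    unfolding tangent_space_alt using assms by blast
qed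

lemma chart_tangent_add:
  assumes "(U, \<phi>) \<in> A" "p \<in> U"
  shows "chart_tangent U \<phi> p (v + w) = chart_tangent U \<phi> p v + chart_tangent U \<phi> p w"
  using linear_frechet_derivative[OF smooth_near_differentiable[OF _ assms]]
  by (auto simp: chart_tangent_def fun_eq_iff linear_add)

lemma chart_tangent_scale:
  assumes "(U, \<phi>) \<in> A" "p \<in> U"
  shows "chart_tangent U \<phi> p (c *\<^sub>R v) = (\<lambda>f. c * chart_tangent U \<phi> p v f)"
  using linear_frechet_derivative[OF smooth_near_differentiable[OF _ assms]]
  by (auto simp: chart_tangent_def fun_eq_iff linear_scale)

lemma tangent_add:
  assumes "u \<in> tangent_space A p" "w \<in> tangent_space A p"
  shows "u + w \<in> tangent_space A p"
proof -
  obtain U \<phi> where U: "(U, \<phi>) \<in> A" "p \<in> U" by (rule chart_cover)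
  then show ?thesis
    using assms unfolding tangent_space_chart[OF U]
    by (auto simp flip: chart_tangent_add[OF U])
qed

lemma tangent_scale:
  assumes "u \<in> tangent_space A p"
  shows "(\<lambda>f. c * u f) \<in> tangent_space A p"
proof -
  obtain U \<phi> where U: "(U, \<phi>) \<in> A" "p \<in> U" by (rule chart_cover)
  then show ?thesis
    using assms unfolding tangent_space_chart[OF U]
    by (auto simp flip: chart_tangent_scale[OF U])
qed

lemma tangentE:
  assumes "u \<in> tangent_space A p"
  obtains U \<phi> v where "(U, \<phi>) \<in> A" "p \<in> U" "u = chart_tangent U \<phi> p v"
  using assms unfolding tangent_space_alt by blast

lemma tangent_const:
  assumes "u \<in> tangent_space A p"
  shows "u (\<lambda>_. c) = 0"
  using assms by (auto elim!: tangentE simp: chart_tangent_def comp_def)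


section \<open>Vector fields\<close>

lemma vector_field_tangent: "vector_field A X \<Longrightarrow> X p \<in> tangent_space A p"
  unfolding vector_field_def by blast

lemma vector_field_smooth: "vector_field A X \<Longrightarrow> smooth_fun A W f \<Longrightarrow> smooth_fun A W (deriv_along X f)"
  unfolding vector_field_def deriv_along_def by blast

lemma vector_field_add:
  "vector_field A X \<Longrightarrow> vector_field A Y \<Longrightarrow> vector_field A (X + Y)"
  unfolding vector_field_def by (simp add: tangent_add smooth_fun_add)

lemma vector_field_scale:
  assumes f: "smooth_fun A UNIV f" and X: "vector_field A X"
  shows "vector_field A (f \<odot> X)"
  unfolding vector_field_def
proof (intro conjI allI impI)
  show "(f \<odot> X) p \<in> tangent_space A p" for p
    unfolding scale_field_def by (intro tangent_scale vector_field_tangent X)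
  fix W h assume h: "smooth_fun A W h"
  then have "smooth_fun A W f"
    using smooth_fun_subset[OF f, of W] smooth_fun_iff by blast
  from smooth_fun_mult[OF this vector_field_smooth[OF X h]]
  show "smooth_fun A W (\<lambda>p. (f \<odot> X) p h)"
    unfolding scale_field_def deriv_along_def .
qed

lemma vector_field_scale_const: "vector_field A X \<Longrightarrow> vector_field A (c *\<^sub>V X)"
  by (rule vector_field_scale[OF smooth_fun_const]) auto

lemma vector_field_minus: "vector_field A X \<Longrightarrow> vector_field A (- X)"
proof -
  assume "vector_field A X"
  moreover have "- X = (-1) *\<^sub>V X"
    by (simp add: scale_field_def fun_eq_iff)
  ultimately show ?thesis by (simp only: vector_field_scale_const)
qed

lemma vector_field_diff:
  "vector_field A X \<Longrightarrow> vector_field A Y \<Longrightarrow> vector_field A (X - Y)"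
  using vector_field_add[of X "- Y"] vector_field_minus[of Y] by simp

text \<open>Global smoothness of \<open>f\<close> excludes the default value 0 in
  \<open>lie_bracket\<close>.\<close>

lemma deriv_along_bracket:
  assumes "vector_field A X" "vector_field A Y" "smooth_fun A UNIV f"
  shows "deriv_along (lie_bracket A X Y) f
    = (\<lambda>p. deriv_along X (deriv_along Y f) p - deriv_along Y (deriv_along X f) p)"
  using smooth_nearI[OF assms(3)] by (simp add: deriv_along_def lie_bracket_def)

lemma deriv_along_const: "vector_field A X \<Longrightarrow> deriv_along X (\<lambda>_. c) = (\<lambda>_. 0)"
  unfolding deriv_along_def by (intro ext tangent_const[OF vector_field_tangent])

end

section \<open>Rules of the metric and of the Levi-Civita connection\<close>

locale levi_civita_manifold = smooth_manifold A
  for A :: "('m::topological_space, 'e::euclidean_space) atlas" +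
  fixes g :: "'m metric" and D :: "'m connection"
  assumes lorentzian: "lorentzian_metric A g" and levi_civita: "levi_civita A g D"
begin

lemma g_sym:
  "u \<in> tangent_space A p \<Longrightarrow> v \<in> tangent_space A p \<Longrightarrow> g p u v = g p v u"
  using lorentzian[unfolded lorentzian_metric_def, THEN conjunct1] by blast

lemma g_add_left:
  "u \<in> tangent_space A p \<Longrightarrow> v \<in> tangent_space A p \<Longrightarrow> w \<in> tangent_space A p \<Longrightarrow>
    g p (u + v) w = g p u w + g p v w"
  using lorentzian[unfolded lorentzian_metric_def, THEN conjunct2, THEN conjunct1] by blast

lemma g_scale_left:
  "u \<in> tangent_space A p \<Longrightarrow> v \<in> tangent_space A p \<Longrightarrow> g p (\<lambda>f. c * u f) v = c * g p u v"
  using lorentzian[unfolded lorentzian_metric_def, THEN conjunct2, THEN conjunct2, THEN conjunct1] by blast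

lemma metric_smooth:
  "vector_field A X \<Longrightarrow> vector_field A Y \<Longrightarrow> smooth_fun A UNIV (metric_tensor g X Y)"
  using lorentzian[unfolded lorentzian_metric_def, THEN conjunct2, THEN conjunct2, THEN conjunct2, THEN conjunct1] by blast

lemma connection_field: "vector_field A X \<Longrightarrow> vector_field A Y \<Longrightarrow> vector_field A (D X Y)"
  using levi_civita unfolding levi_civita_def affine_connection_def by blast

lemma connection_add:
  assumes "vector_field A X" "vector_field A Y" "vector_field A Z"
  shows connection_add_left: "D (X + Y) Z = D X Z + D Y Z"
    and connection_add_right: "D X (Y + Z) = D X Y + D X Z"
  using levi_civita assms unfolding levi_civita_def affine_connection_def by blast+

lemma connection_scale:
  assumes "smooth_fun A UNIV f" "vector_field A X" "vector_field A Y"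
  shows connection_scale_left: "D (f \<odot> X) Y = f \<odot> D X Y"
    and connection_scale_right: "D X (f \<odot> Y) = deriv_along X f \<odot> Y + f \<odot> D X Y"
  using levi_civita assms unfolding levi_civita_def affine_connection_def by blast+

lemma torsion_free:
  "vector_field A X \<Longrightarrow> vector_field A Y \<Longrightarrow> lie_bracket A X Y = D X Y - D Y X"
  using levi_civita unfolding levi_civita_def by simp

lemma metric_compatible:
  assumes "vector_field A X" "vector_field A Y" "vector_field A Z"
  shows "deriv_along X (metric_tensor g Y Z) p
      = metric_tensor g (D X Y) Z p + metric_tensor g Y (D X Z) p"
proof -
  have "deriv_along X (metric_tensor g Y Z) = metric_tensor g (D X Y) Z + metric_tensor g Y (D X Z)"
    using levi_civita assms unfolding levi_civita_def by blast
  then show ?thesis by simp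
qed

text \<open>The torsion-free axiom writes the bracket as a difference of two vector fields, which
  replaces a coordinate computation with second derivatives.\<close>

lemma bracket_field: "vector_field A X \<Longrightarrow> vector_field A Y \<Longrightarrow> vector_field A (lie_bracket A X Y)"
  by (simp add: torsion_free connection_field vector_field_diff)

lemma connection_diff_left:
  assumes "vector_field A X" "vector_field A Y" "vector_field A Z"
  shows "D (X - Y) Z = D X Z - D Y Z"
  using connection_add_left[OF vector_field_diff[OF assms(1,2)] assms(2,3)] by simp

lemma connection_scale_const:
  assumes "vector_field A X" "vector_field A Y"
  shows "D (c *\<^sub>V X) Y = c *\<^sub>V D X Y" and "D X (c *\<^sub>V Y) = c *\<^sub>V D X Y"
  using connection_scale[OF smooth_fun_const assms, of c] deriv_along_const[OF assms(1), of c]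
  by (simp_all add: scale_field_def fun_eq_iff)

lemmas fields = connection_field bracket_field vector_field_add vector_field_diff
  vector_field_scale vector_field_scale_const vector_field_smooth


section \<open>Tensoriality\<close>

text \<open>Linearity over the globally smooth functions. Since the frame used below is global, this
  already determines \<open>T\<close> from its values on three fields.\<close>

definition tensorial :: "('m vfield \<Rightarrow> 'm \<Rightarrow> real) \<Rightarrow> bool" where
  "tensorial T \<longleftrightarrow>
    (\<forall>X Y p. vector_field A X \<longrightarrow> vector_field A Y \<longrightarrow> T (X + Y) p = T X p + T Y p) \<and>
    (\<forall>f X p. smooth_fun A UNIV f \<longrightarrow> vector_field A X \<longrightarrow> T (f \<odot> X) p = f p * T X p)"

lemma tensorial_add:
  "tensorial T \<Longrightarrow> vector_field A X \<Longrightarrow> vector_field A Y \<Longrightarrow> T (X + Y) p = T X p + T Y p"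
  unfolding tensorial_def by blast

lemma tensorial_scale:
  "tensorial T \<Longrightarrow> smooth_fun A UNIV f \<Longrightarrow> vector_field A X \<Longrightarrow> T (f \<odot> X) p = f p * T X p"
  unfolding tensorial_def by blast

lemma tensorial_scale_const:
  "tensorial T \<Longrightarrow> vector_field A X \<Longrightarrow> T (c *\<^sub>V X) p = c * T X p"
  by (rule tensorial_scale[OF _ smooth_fun_const]) auto

lemma tensorial_minus:
  assumes "tensorial T" "vector_field A X"
  shows "T (- X) p = - T X p"
proof -
  have "- X = (-1) *\<^sub>V X"
    by (simp add: scale_field_def fun_eq_iff)
  then show ?thesis
    using tensorial_scale_const[OF assms, of "-1" p] by (simp only:)
qed

lemma tensorial_diff:
  assumes "tensorial T" "vector_field A X" "vector_field A Y"
  shows "T (X - Y) p = T X p - T Y p"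
  using tensorial_add[OF assms(1,2) vector_field_minus[OF assms(3)]] tensorial_minus[OF assms(1,3)]
  by simp

lemma tensorial_sum:
  "tensorial S \<Longrightarrow> tensorial T \<Longrightarrow> tensorial (\<lambda>X p. S X p + T X p)"
  unfolding tensorial_def by (simp add: algebra_simps)

lemma tensorial_difference:
  "tensorial S \<Longrightarrow> tensorial T \<Longrightarrow> tensorial (\<lambda>X p. S X p - T X p)"
  unfolding tensorial_def by (simp add: algebra_simps)

lemma tensorial_mult_left: "tensorial T \<Longrightarrow> tensorial (\<lambda>X p. f p * T X p)"
  unfolding tensorial_def by (simp add: algebra_simps)

lemma tensorial_mult_right: "tensorial T \<Longrightarrow> tensorial (\<lambda>X p. T X p * f p)"
  unfolding tensorial_def by (simp add: algebra_simps)

lemma metric_sym: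
  "vector_field A X \<Longrightarrow> vector_field A Y \<Longrightarrow> metric_tensor g X Y p = metric_tensor g Y X p"
  unfolding metric_tensor_def by (intro g_sym vector_field_tangent)

lemma metric_tensorial_left:
  assumes "vector_field A Y"
  shows "tensorial (\<lambda>X. metric_tensor g X Y)"
  unfolding tensorial_def
proof (intro conjI allI impI)
  fix X X' p assume "vector_field A X" "vector_field A X'"
  then show "metric_tensor g (X + X') Y p = metric_tensor g X Y p + metric_tensor g X' Y p"
    using assms g_add_left[of "X p" p "X' p" "Y p"]
    by (simp add: metric_tensor_def vector_field_tangent)
next
  fix f X p assume "smooth_fun A UNIV f" "vector_field A X"
  then show "metric_tensor g (f \<odot> X) Y p = f p * metric_tensor g X Y p"
    using assms g_scale_left[of "X p" p "Y p" "f p"]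
    by (simp add: metric_tensor_def scale_field_def vector_field_tangent)
qed

lemma metric_tensorial_right:
  assumes "vector_field A X"
  shows "tensorial (metric_tensor g X)"
  unfolding tensorial_def
proof (intro conjI allI impI)
  fix Y Z p assume YZ: "vector_field A Y" "vector_field A Z"
  then show "metric_tensor g X (Y + Z) p = metric_tensor g X Y p + metric_tensor g X Z p"
    using tensorial_add[OF metric_tensorial_left[OF assms] YZ, of p] assms
    by (simp add: metric_sym[of X] vector_field_add)
next
  fix f Y p assume fY: "smooth_fun A UNIV f" "vector_field A Y"
  then show "metric_tensor g X (f \<odot> Y) p = f p * metric_tensor g X Y p"
    using tensorial_scale[OF metric_tensorial_left[OF assms] fY, of p] assms
    by (simp add: metric_sym[of X] vector_field_scale)
qed

text \<open>Applied with \<open>F\<close> the covariant derivative of a fixed field, as a function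
  of the direction, or the curvature operator as a function of one slot.\<close>

lemma tensorial_metric_comp_left:
  assumes "vector_field A Y"
    and "\<And>X. vector_field A X \<Longrightarrow> vector_field A (F X)"
    and "\<And>X X'. vector_field A X \<Longrightarrow> vector_field A X' \<Longrightarrow> F (X + X') = F X + F X'"
    and "\<And>f X. smooth_fun A UNIV f \<Longrightarrow> vector_field A X \<Longrightarrow> F (f \<odot> X) = f \<odot> F X"
  shows "tensorial (\<lambda>X. metric_tensor g (F X) Y)"
  using metric_tensorial_left[OF assms(1)] assms(2-) unfolding tensorial_def by simp

text \<open>Expanding the derivative of the metric by compatibility and the brackets by
  torsion-freeness, the terms with \<open>D V X\<close> and \<open>D V Y\<close> cancel. The fields
  \<open>X\<close> and \<open>Y\<close> are then no longer differentiated.\<close>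

lemma lie_derivative_metric_eq:
  assumes "vector_field A V" "vector_field A X" "vector_field A Y"
  shows "lie_derivative_metric A g V X Y
    = (\<lambda>p. metric_tensor g (D X V) Y p + metric_tensor g (D Y V) X p)"
proof
  fix p
  show "lie_derivative_metric A g V X Y p
    = metric_tensor g (D X V) Y p + metric_tensor g (D Y V) X p"
    unfolding lie_derivative_metric_def
    using assms metric_sym[of X "D Y V" p]
    by (simp add: metric_compatible torsion_free connection_field
        tensorial_diff[OF metric_tensorial_left] tensorial_diff[OF metric_tensorial_right])
qed

lemma lie_derivative_metric_sym:
  assumes "vector_field A V" "vector_field A X" "vector_field A Y"
  shows "lie_derivative_metric A g V X Y p = lie_derivative_metric A g V Y X p"
  using assms by (simp add: lie_derivative_metric_eq)

lemma tensorial_cong: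
  assumes "tensorial T" "\<And>X. vector_field A X \<Longrightarrow> S X = T X"
  shows "tensorial S"
  using assms unfolding tensorial_def by (simp add: vector_field_add vector_field_scale)

lemma lie_derivative_metric_tensorial:
  assumes "vector_field A V" "vector_field A Y"
  shows "tensorial (\<lambda>X. lie_derivative_metric A g V X Y)"
    and "tensorial (lie_derivative_metric A g V Y)"
proof -
  have "tensorial (\<lambda>X p. metric_tensor g (D X V) Y p + metric_tensor g (D Y V) X p)"
    using assms
    by (intro tensorial_sum tensorial_metric_comp_left metric_tensorial_right)
      (simp_all add: fields connection_add_left connection_scale_left)
  then show l: "tensorial (\<lambda>X. lie_derivative_metric A g V X Y)"
    by (rule tensorial_cong) (simp add: lie_derivative_metric_eq assms)
  show "tensorial (lie_derivative_metric A g V Y)"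
    by (rule tensorial_cong[OF l]) (simp add: lie_derivative_metric_sym assms fun_eq_iff)
qed

section \<open>Tensoriality of the curvature\<close>

lemma curvature_op_eq:
  assumes "vector_field A X" "vector_field A Y" "vector_field A Z"
  shows "curvature_op A D X Y Z = D X (D Y Z) - D Y (D X Z) - (D (D X Y) Z - D (D Y X) Z)"
  using assms by (simp add: curvature_op_def torsion_free connection_diff_left connection_field)

lemma curvature_op_field:
  assumes "vector_field A X" "vector_field A Y" "vector_field A Z"
  shows "vector_field A (curvature_op A D X Y Z)"
  unfolding curvature_op_def using assms by (intro fields)

lemma curvature_op_antisym:
  assumes "vector_field A X" "vector_field A Y" "vector_field A Z"
  shows "curvature_op A D Y X Z = - curvature_op A D X Y Z"
  using assms by (simp add: curvature_op_eq)

lemma curvature_op_add: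
  assumes "vector_field A X" "vector_field A X'" "vector_field A Y" "vector_field A Z"
  shows "curvature_op A D (X + X') Y Z = curvature_op A D X Y Z + curvature_op A D X' Y Z"
    and "curvature_op A D Y Z (X + X') = curvature_op A D Y Z X + curvature_op A D Y Z X'"
  using assms
  by (simp_all add: curvature_op_eq fields connection_add_left connection_add_right)

text \<open>In the first slot, the Leibniz term of \<open>D Y (f \<odot> D X Z)\<close> cancels the
  one produced by \<open>D (D Y (f \<odot> X)) Z\<close>. In the last slot the mixed first-order
  terms cancel, and the second derivatives of \<open>f\<close> combine to the commutator minus the
  bracket applied to \<open>f\<close>, which is 0 by \<open>deriv_along_bracket\<close>.\<close>

lemma curvature_op_scale:
  assumes "smooth_fun A UNIV f" "vector_field A X" "vector_field A Y" "vector_field A Z"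
  shows "curvature_op A D (f \<odot> X) Y Z = f \<odot> curvature_op A D X Y Z"
    and "curvature_op A D Y Z (f \<odot> X) = f \<odot> curvature_op A D Y Z X"
proof -
  show "curvature_op A D (f \<odot> X) Y Z = f \<odot> curvature_op A D X Y Z"
    using assms
    by (simp add: curvature_op_eq fields connection_add_left connection_scale_left
        connection_scale_right)
      (simp add: scale_field_def fun_eq_iff algebra_simps)
  show "curvature_op A D Y Z (f \<odot> X) = f \<odot> curvature_op A D Y Z X"
    using assms
    by (simp add: curvature_op_def fields connection_add_right connection_scale_right)
      (simp add: scale_field_def fun_eq_iff algebra_simps deriv_along_bracket)
qed

lemma curvature_tensor_tensorial:
  assumes "vector_field A X" "vector_field A Y" "vector_field A Z"
  shows "tensorial (\<lambda>W. curvature_tensor A g D W X Y Z)"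
    and "tensorial (\<lambda>W. curvature_tensor A g D X W Y Z)"
    and "tensorial (\<lambda>W. curvature_tensor A g D X Y W Z)"
    and "tensorial (\<lambda>W. curvature_tensor A g D X Y Z W)"
proof -
  have neg: "tensorial (\<lambda>W p. - T W p)" if "tensorial T" for T
    using that unfolding tensorial_def by simp
  show l: "tensorial (\<lambda>W. curvature_tensor A g D W X Y Z)"
    unfolding curvature_tensor_def using assms
    by (intro neg tensorial_metric_comp_left)
      (simp_all add: curvature_op_field curvature_op_add curvature_op_scale)
  show "tensorial (\<lambda>W. curvature_tensor A g D X Y W Z)"
    unfolding curvature_tensor_def using assms
    by (intro neg tensorial_metric_comp_left)
      (simp_all add: curvature_op_field curvature_op_add curvature_op_scale)
  show "tensorial (\<lambda>W. curvature_tensor A g D X Y Z W)"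
    unfolding curvature_tensor_def using assms
    by (intro neg metric_tensorial_right curvature_op_field)
  \<comment> \<open>The second slot reduces to the first by antisymmetry.\<close>
  show "tensorial (\<lambda>W. curvature_tensor A g D X W Y Z)"
  proof (rule tensorial_cong[OF neg[OF l]])
    fix W assume "vector_field A W"
    then show "curvature_tensor A g D X W Y Z = (\<lambda>p. - curvature_tensor A g D W X Y Z p)"
      using assms curvature_op_antisym[of W X Y]
      by (simp add: curvature_tensor_def tensorial_minus[OF metric_tensorial_left] curvature_op_field)
  qed
qed

lemma kulkarni_nomizu_tensorial:
  assumes "vector_field A X" "vector_field A Y" "vector_field A Z"
    and S: "\<And>V. vector_field A V \<Longrightarrow> tensorial (\<lambda>W. S W V)" "\<And>V. vector_field A V \<Longrightarrow> tensorial (S V)"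
    and T: "\<And>V. vector_field A V \<Longrightarrow> tensorial (\<lambda>W. T W V)" "\<And>V. vector_field A V \<Longrightarrow> tensorial (T V)"
  shows "tensorial (\<lambda>W. kulkarni_nomizu S T W X Y Z)"
    and "tensorial (\<lambda>W. kulkarni_nomizu S T X W Y Z)"
    and "tensorial (\<lambda>W. kulkarni_nomizu S T X Y W Z)"
    and "tensorial (\<lambda>W. kulkarni_nomizu S T X Y Z W)"
  unfolding kulkarni_nomizu_def using assms(1-3)
  by - (intro tensorial_sum tensorial_difference tensorial_mult_left tensorial_mult_right S T;
      assumption)+

text \<open>With both sides moved to one, the soliton equation is the vanishing of a tensor and can
  be tested on a frame.\<close>

definition soliton_defect :: "'m vfield \<Rightarrow> real \<Rightarrow> 'm tensor4" where
  "soliton_defect V lam X Y Z W = (\<lambda>p. curvature_tensor A g D X Y Z W p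
     + 1/2 * kulkarni_nomizu (lie_derivative_metric A g V) (metric_tensor g) X Y Z W p
     - lam/2 * kulkarni_nomizu (metric_tensor g) (metric_tensor g) X Y Z W p)"

lemma soliton_defect_tensorial:
  assumes "vector_field A V" "vector_field A X" "vector_field A Y" "vector_field A Z"
  shows "tensorial (\<lambda>W. soliton_defect V lam W X Y Z)"
    and "tensorial (\<lambda>W. soliton_defect V lam X W Y Z)"
    and "tensorial (\<lambda>W. soliton_defect V lam X Y W Z)"
    and "tensorial (\<lambda>W. soliton_defect V lam X Y Z W)"
  unfolding soliton_defect_def using assms
  by - (intro tensorial_sum tensorial_difference tensorial_mult_left kulkarni_nomizu_tensorial
      curvature_tensor_tensorial lie_derivative_metric_tensorial metric_tensorial_left
      metric_tensorial_right; assumption)+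

text \<open>Koszul's formula for fields with constant mutual products: the three derivative terms
  vanish, and the three compatibility equations combine with torsion-freeness.\<close>

lemma koszul:
  assumes "vector_field A X" "vector_field A Y" "vector_field A Z"
    and "metric_tensor g X Y = (\<lambda>_. a)" "metric_tensor g Y Z = (\<lambda>_. b)"
      "metric_tensor g X Z = (\<lambda>_. c)"
  shows "2 * metric_tensor g (D X Y) Z p = metric_tensor g (lie_bracket A X Y) Z p
    - metric_tensor g (lie_bracket A Y Z) X p + metric_tensor g (lie_bracket A Z X) Y p"
proof -
  have "metric_tensor g (D X Y) Z p + metric_tensor g Y (D X Z) p = 0"
    "metric_tensor g (D Y Z) X p + metric_tensor g Z (D Y X) p = 0"
    "metric_tensor g (D Z X) Y p + metric_tensor g X (D Z Y) p = 0"
    using metric_compatible[of X Y Z p] metric_compatible[of Y X Z p] metric_compatible[of Z X Y p]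
      assms metric_sym[of _ _ p]
    by (simp_all add: deriv_along_const connection_field)
  moreover have "metric_tensor g Y (D X Z) p = metric_tensor g (D X Z) Y p"
    "metric_tensor g Z (D Y X) p = metric_tensor g (D Y X) Z p"
    "metric_tensor g X (D Z Y) p = metric_tensor g (D Z Y) X p"
    using assms by (simp_all add: metric_sym connection_field)
  ultimately show ?thesis
    using assms by (simp add: torsion_free connection_field tensorial_diff[OF metric_tensorial_left])
qed

end


section \<open>Pseudo-orthonormal frames\<close>

locale pseudo_orthonormal_frame = levi_civita_manifold A g D
  for A :: "('m::topological_space, real^3) atlas" and g D +
  fixes e1 e2 e3 :: "'m vfield"
  assumes frame_fields: "vector_field A e1" "vector_field A e2" "vector_field A e3"
    and orthonormal: "pseudo_orthonormal3 g e1 e2 e3"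
begin

text \<open>Constant coefficients suffice because, under the bracket relations imposed below, the
  connection and the curvature map such fields to such fields. Computations then take place on
  triples of reals.\<close>

definition comb :: "real \<Rightarrow> real \<Rightarrow> real \<Rightarrow> 'm vfield" where
  "comb a b c = a *\<^sub>V e1 + b *\<^sub>V e2 + c *\<^sub>V e3"

lemma comb_apply: "comb a b c p f = a * e1 p f + b * e2 p f + c * e3 p f"
  by (simp add: comb_def scale_field_def)

lemma frame_eq_comb: "e1 = comb 1 0 0" "e2 = comb 0 1 0" "e3 = comb 0 0 1"
  by (simp_all add: fun_eq_iff comb_apply)

lemma frame_field: "E \<in> {e1, e2, e3} \<Longrightarrow> vector_field A E"
  using frame_fields by auto

lemma comb_field: "vector_field A (comb a b c)"
  unfolding comb_def by (intro fields frame_fields)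

lemma comb_add: "comb a b c + comb a' b' c' = comb (a + a') (b + b') (c + c')"
  by (simp add: fun_eq_iff comb_apply algebra_simps)

lemma comb_diff: "comb a b c - comb a' b' c' = comb (a - a') (b - b') (c - c')"
  by (simp add: fun_eq_iff comb_apply algebra_simps)

lemma comb_scale: "r *\<^sub>V comb a b c = comb (r * a) (r * b) (r * c)"
  by (simp add: fun_eq_iff comb_apply scale_field_def algebra_simps)

lemma metric_frame:
  "metric_tensor g e1 e1 p = 1" "metric_tensor g e2 e2 p = 1" "metric_tensor g e3 e3 p = - 1"
  "metric_tensor g e1 e2 p = 0" "metric_tensor g e1 e3 p = 0" "metric_tensor g e2 e3 p = 0"
  "metric_tensor g e2 e1 p = 0" "metric_tensor g e3 e1 p = 0" "metric_tensor g e3 e2 p = 0"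
  using orthonormal metric_sym[OF frame_fields(1,2), of p] metric_sym[OF frame_fields(1,3), of p]
    metric_sym[OF frame_fields(2,3), of p]
  unfolding pseudo_orthonormal3_def by simp_all

lemma metric_comb: "metric_tensor g (comb a b c) (comb a' b' c') p = a * a' + b * b' - c * c'"
proof -
  have "metric_tensor g (comb a b c) e p
      = a * metric_tensor g e1 e p + b * metric_tensor g e2 e p + c * metric_tensor g e3 e p"
    if "vector_field A e" for e
    using that
    by (simp add: comb_def fields frame_fields tensorial_add[OF metric_tensorial_left]
        tensorial_scale_const[OF metric_tensorial_left])
  moreover have "metric_tensor g X (comb a' b' c') p
      = a' * metric_tensor g X e1 p + b' * metric_tensor g X e2 p + c' * metric_tensor g X e3 p"
    if "vector_field A X" for X
    using that
    by (simp add: comb_def fields frame_fields tensorial_add[OF metric_tensorial_right]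
        tensorial_scale_const[OF metric_tensorial_right])
  ultimately show ?thesis
    by (simp add: comb_field frame_fields metric_frame)
qed

text \<open>The orthonormality relations make the chart coordinates of the frame linearly independent,
  and three independent vectors span the coordinate space.\<close>

lemma tangent_comb:
  assumes "u \<in> tangent_space A p"
  obtains a b c where "u = comb a b c p"
proof -
  obtain U \<phi> where U: "(U, \<phi>) \<in> A" "p \<in> U" by (rule chart_cover)
  let ?L = "chart_tangent U \<phi> p"
  have "e1 p \<in> range ?L" "e2 p \<in> range ?L" "e3 p \<in> range ?L"
    using vector_field_tangent[OF frame_fields(1), of p] vector_field_tangent[OF frame_fields(2), of p]
      vector_field_tangent[OF frame_fields(3), of p] tangent_space_chart[OF U] by simp_all
  then obtain v1 v2 v3 where v: "e1 p = ?L v1" "e2 p = ?L v2" "e3 p = ?L v3"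
    by blast
  define M where "M c = c $ 1 *\<^sub>R v1 + c $ 2 *\<^sub>R v2 + c $ 3 *\<^sub>R v3" for c :: "real^3"
  have LM: "?L (M c) = comb (c $ 1) (c $ 2) (c $ 3) p" for c
    by (simp add: M_def chart_tangent_add[OF U] chart_tangent_scale[OF U] comb_apply fun_eq_iff v)
  have "linear M"
    by (rule linearI) (simp_all add: M_def algebra_simps)
  moreover have "inj M"
    unfolding linear_injective_0[OF \<open>linear M\<close>]
  proof (intro allI impI)
    fix c assume "M c = 0"
    then have "comb (c $ 1) (c $ 2) (c $ 3) p = comb 0 0 0 p"
      using LM[of c] LM[of 0] by (simp add: M_def)
    \<comment> \<open>The metric at \<open>p\<close> sees only the tangent vectors at
      \<open>p\<close>. Pairing with the frame returns the entries of \<open>c\<close>, the third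
      with a minus sign, so all of them are 0.\<close>
    then have "metric_tensor g (comb (c $ 1) (c $ 2) (c $ 3)) X p = metric_tensor g (comb 0 0 0) X p"
      for X by (simp add: metric_tensor_def)
    from this[of "comb 1 0 0"] this[of "comb 0 1 0"] this[of "comb 0 0 1"]
    show "c = 0" by (simp add: metric_comb vec_eq_iff forall_3)
  qed
  ultimately have "surj M"
    by (rule linear_injective_imp_surjective[OF _ _ refl])
  moreover obtain v where "u = ?L v"
    using assms tangent_space_chart[OF U] by blast
  ultimately show ?thesis
    using LM that by (metis surjD)
qed

text \<open>The coefficients are metric products, hence globally smooth; the minus sign comes from
  the timelike \<open>e3\<close>.\<close>

lemma frame_expansion:
  assumes "vector_field A X"
  shows "X = metric_tensor g X e1 \<odot> e1 + metric_tensor g X e2 \<odot> e2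
    + (\<lambda>p. - metric_tensor g X e3 p) \<odot> e3"
proof
  fix p
  obtain x y z where X: "X p = comb x y z p"
    using tangent_comb[OF vector_field_tangent[OF assms]] .
  then have *: "metric_tensor g X Y p = metric_tensor g (comb x y z) Y p" for Y
    by (simp add: metric_tensor_def)
  have "metric_tensor g X e1 p = x" "metric_tensor g X e2 p = y" "metric_tensor g X e3 p = - z"
    unfolding * by (subst frame_eq_comb, simp add: metric_comb)+
  then show "X p = (metric_tensor g X e1 \<odot> e1 + metric_tensor g X e2 \<odot> e2
      + (\<lambda>p. - metric_tensor g X e3 p) \<odot> e3) p"
    by (simp add: X fun_eq_iff comb_apply scale_field_def)
qed

lemma comb_eqI:
  assumes "vector_field A X" "\<And>p. metric_tensor g X e1 p = a"
    "\<And>p. metric_tensor g X e2 p = b" "\<And>p. metric_tensor g X e3 p = - c"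
  shows "X = comb a b c"
proof -
  have "metric_tensor g X e1 = (\<lambda>_. a)" "metric_tensor g X e2 = (\<lambda>_. b)"
    "(\<lambda>p. - metric_tensor g X e3 p) = (\<lambda>_. c)"
    using assms(2-4) by auto
  with frame_expansion[OF assms(1)] show ?thesis
    unfolding comb_def by simp
qed

text \<open>Expand \<open>X\<close> in the frame and pull out the smooth coefficient
  functions.\<close>

lemma tensorial_eq_0:
  assumes "tensorial T" "vector_field A X" "T e1 p = 0" "T e2 p = 0" "T e3 p = 0"
  shows "T X p = 0"
proof -
  have "smooth_fun A UNIV (\<lambda>p. - metric_tensor g X e3 p)"
    using smooth_fun_mult[OF smooth_fun_const[of UNIV "-1"] metric_smooth[OF assms(2) frame_fields(3)]]
    by simp
  moreover note metric_smooth[OF assms(2) frame_fields(1)] metric_smooth[OF assms(2) frame_fields(2)]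
  ultimately have "T (metric_tensor g X e1 \<odot> e1 + metric_tensor g X e2 \<odot> e2
      + (\<lambda>p. - metric_tensor g X e3 p) \<odot> e3) p = 0"
    using assms(3-)
    by (simp add: tensorial_add[OF assms(1)] tensorial_scale[OF assms(1)] fields frame_fields)
  then show ?thesis
    using frame_expansion[OF assms(2)] by simp
qed

lemma soliton_defect_eq_0:
  assumes V: "vector_field A V"
    and frame: "\<And>X Y Z W. X \<in> {e1, e2, e3} \<Longrightarrow> Y \<in> {e1, e2, e3} \<Longrightarrow> Z \<in> {e1, e2, e3} \<Longrightarrow>
      W \<in> {e1, e2, e3} \<Longrightarrow> soliton_defect V lam X Y Z W p = 0"
    and X: "vector_field A X" and Y: "vector_field A Y" and Z: "vector_field A Z"
    and W: "vector_field A W"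
  shows "soliton_defect V lam X Y Z W p = 0"
proof -
  \<comment> \<open>Arbitrary fields enter one slot at a time from the left, while the slots further
    right still hold frame fields.\<close>
  have 1: "soliton_defect V lam X E F H p = 0"
    if E: "E \<in> {e1, e2, e3}" and F: "F \<in> {e1, e2, e3}" and H: "H \<in> {e1, e2, e3}" for E F H
    by (rule tensorial_eq_0[OF soliton_defect_tensorial(1)[OF V frame_field[OF E] frame_field[OF F] frame_field[OF H]] X];
        rule frame[OF _ E F H]; simp)
  have 2: "soliton_defect V lam X Y F H p = 0"
    if F: "F \<in> {e1, e2, e3}" and H: "H \<in> {e1, e2, e3}" for F H
    by (rule tensorial_eq_0[OF soliton_defect_tensorial(2)[OF V X frame_field[OF F] frame_field[OF H]] Y];
        rule 1[OF _ F H]; simp)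
  have 3: "soliton_defect V lam X Y Z H p = 0" if H: "H \<in> {e1, e2, e3}" for H
    by (rule tensorial_eq_0[OF soliton_defect_tensorial(3)[OF V X Y frame_field[OF H]] Z];
        rule 2[OF _ H]; simp)
  show ?thesis
    by (rule tensorial_eq_0[OF soliton_defect_tensorial(4)[OF V X Y Z] W]; rule 3; simp)
qed

lemma left_invariant_comb:
  assumes "left_invariant_field A mul e1" "left_invariant_field A mul e2"
    "left_invariant_field A mul e3"
  shows "left_invariant_field A mul (comb a b c)"
  using assms unfolding left_invariant_field_def
  by (simp add: comb_field fun_eq_iff comb_apply differential_def)

end


section \<open>Connection and curvature of the group\<close>

locale lorentzian_g6 = pseudo_orthonormal_frame A g D e1 e2 e3
  for A :: "('m::topological_space, real^3) atlas" and g D e1 e2 e3 +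
  fixes \<alpha> \<beta> \<gamma> \<delta> :: real
  assumes relation: "\<alpha> * \<gamma> = \<beta> * \<delta>"
    and brackets: "lie_bracket A e1 e2 = \<alpha> *\<^sub>V e2 + \<beta> *\<^sub>V e3"
      "lie_bracket A e1 e3 = \<gamma> *\<^sub>V e2 + \<delta> *\<^sub>V e3" "lie_bracket A e2 e3 = 0"
begin

lemma bracket_frame:
  "lie_bracket A e1 e1 = comb 0 0 0" "lie_bracket A e1 e2 = comb 0 \<alpha> \<beta>"
  "lie_bracket A e1 e3 = comb 0 \<gamma> \<delta>"
  "lie_bracket A e2 e1 = comb 0 (- \<alpha>) (- \<beta>)" "lie_bracket A e2 e2 = comb 0 0 0"
  "lie_bracket A e2 e3 = comb 0 0 0"
  "lie_bracket A e3 e1 = comb 0 (- \<gamma>) (- \<delta>)" "lie_bracket A e3 e2 = comb 0 0 0"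
  "lie_bracket A e3 e3 = comb 0 0 0"
proof -
  have *: "lie_bracket A Y X = - lie_bracket A X Y" for X Y
    by (simp add: lie_bracket_def fun_eq_iff)
  show r: "lie_bracket A e1 e2 = comb 0 \<alpha> \<beta>" "lie_bracket A e1 e3 = comb 0 \<gamma> \<delta>"
    "lie_bracket A e2 e3 = comb 0 0 0"
    by (simp_all add: brackets fun_eq_iff comb_apply scale_field_def)
  show "lie_bracket A e2 e1 = comb 0 (- \<alpha>) (- \<beta>)" "lie_bracket A e3 e1 = comb 0 (- \<gamma>) (- \<delta>)"
    "lie_bracket A e3 e2 = comb 0 0 0"
    using *[of e2 e1] *[of e3 e1] *[of e3 e2] r by (simp_all add: fun_eq_iff comb_apply)
  show "lie_bracket A e1 e1 = comb 0 0 0" "lie_bracket A e2 e2 = comb 0 0 0"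
    "lie_bracket A e3 e3 = comb 0 0 0"
    by (simp_all add: lie_bracket_def fun_eq_iff comb_apply)
qed

lemma metric_comb_frame:
  "metric_tensor g (comb a b c) e1 p = a" "metric_tensor g (comb a b c) e2 p = b"
  "metric_tensor g (comb a b c) e3 p = - c"
  using metric_comb[of a b c 1 0 0 p] metric_comb[of a b c 0 1 0 p] metric_comb[of a b c 0 0 1 p]
  by (simp_all flip: frame_eq_comb)

text \<open>Koszul's formula gives the products of each derivative with \<open>e1\<close>,
  \<open>e2\<close>, \<open>e3\<close>, and by \<open>comb_eqI\<close> these determine the
  field.\<close>

lemma connection_frame:
  "D e1 e1 = comb 0 0 0" "D e1 e2 = comb 0 0 ((\<beta> + \<gamma>) / 2)" "D e1 e3 = comb 0 ((\<beta> + \<gamma>) / 2) 0"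
  "D e2 e1 = comb 0 (- \<alpha>) ((\<gamma> - \<beta>) / 2)" "D e2 e2 = comb \<alpha> 0 0" "D e2 e3 = comb ((\<gamma> - \<beta>) / 2) 0 0"
  "D e3 e1 = comb 0 ((\<beta> - \<gamma>) / 2) (- \<delta>)" "D e3 e2 = comb ((\<gamma> - \<beta>) / 2) 0 0"
  "D e3 e3 = comb (- \<delta>) 0 0"
proof -
  \<comment> \<open>\<open>undefined\<close> is just some point: frame products have the same value
    everywhere.\<close>
  have const: "metric_tensor g X Y = (\<lambda>_. metric_tensor g X Y undefined)"
    if "X \<in> {e1, e2, e3}" "Y \<in> {e1, e2, e3}" for X Y
    by (rule ext) (use that in \<open>auto simp: metric_frame\<close>)
  have *: "metric_tensor g (D X Y) Z p = (metric_tensor g (lie_bracket A X Y) Z p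
      - metric_tensor g (lie_bracket A Y Z) X p + metric_tensor g (lie_bracket A Z X) Y p) / 2"
    if X: "X \<in> {e1, e2, e3}" and Y: "Y \<in> {e1, e2, e3}" and Z: "Z \<in> {e1, e2, e3}" for X Y Z p
    using koszul[OF frame_field[OF X] frame_field[OF Y] frame_field[OF Z]
        const[OF X Y] const[OF Y Z] const[OF X Z], of p]
    by (simp add: field_simps)
  show "D e1 e1 = comb 0 0 0" "D e1 e2 = comb 0 0 ((\<beta> + \<gamma>) / 2)"
    "D e1 e3 = comb 0 ((\<beta> + \<gamma>) / 2) 0" "D e2 e1 = comb 0 (- \<alpha>) ((\<gamma> - \<beta>) / 2)"
    "D e2 e2 = comb \<alpha> 0 0" "D e2 e3 = comb ((\<gamma> - \<beta>) / 2) 0 0"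
    "D e3 e1 = comb 0 ((\<beta> - \<gamma>) / 2) (- \<delta>)" "D e3 e2 = comb ((\<gamma> - \<beta>) / 2) 0 0"
    "D e3 e3 = comb (- \<delta>) 0 0"
    by (intro comb_eqI connection_field frame_fields;
        simp add: * bracket_frame metric_comb_frame field_simps)+
qed

lemma connection_comb:
  assumes "vector_field A X"
  shows "D (comb a b c) X = a *\<^sub>V D e1 X + b *\<^sub>V D e2 X + c *\<^sub>V D e3 X"
    and "D X (comb a b c) = a *\<^sub>V D X e1 + b *\<^sub>V D X e2 + c *\<^sub>V D X e3"
  using assms unfolding comb_def
  by (simp_all add: fields frame_fields connection_add_left connection_add_right
      connection_scale_const)

lemma connection_comb_comb:
  "D (comb a b c) (comb x y z) =
    comb (b * \<alpha> * y + (\<gamma> - \<beta>) / 2 * (b * z + c * y) - c * \<delta> * z)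
      (a * (\<beta> + \<gamma>) / 2 * z - b * \<alpha> * x + c * (\<beta> - \<gamma>) / 2 * x)
      (a * (\<beta> + \<gamma>) / 2 * y + b * (\<gamma> - \<beta>) / 2 * x - c * \<delta> * x)"
  by (simp add: connection_comb comb_field frame_fields connection_frame comb_scale comb_add)
    (simp add: algebra_simps add_divide_distrib diff_divide_distrib)

text \<open>Up to sign, the sectional curvatures of the planes spanned by \<open>e1, e2\<close>, by \<open>e1, e3\<close> and by
  \<open>e2, e3\<close>.\<close>

definition K12 :: real where "K12 = \<alpha>\<^sup>2 - (\<beta> - \<gamma>) * (3 * \<beta> + \<gamma>) / 4"
definition K13 :: real where "K13 = \<delta>\<^sup>2 + (\<beta> - \<gamma>) * (\<beta> + 3 * \<gamma>) / 4"
definition K23 :: real where "K23 = \<alpha> * \<delta> + (\<beta> - \<gamma>)\<^sup>2 / 4"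

text \<open>The differences such as \<open>a * b' - a' * b\<close> are the coordinates of the
  bivector of the first two arguments. Each is multiplied by a single constant, so the curvature
  operator is diagonal on bivectors.\<close>

lemma curvature_comb:
  "curvature_op A D (comb a b c) (comb a' b' c') (comb x y z) =
    comb ((a * c' - a' * c) * K13 * z - (a * b' - a' * b) * K12 * y)
      ((a * b' - a' * b) * K12 * x + (b * c' - b' * c) * K23 * z)
      ((a * c' - a' * c) * K13 * x + (b * c' - b' * c) * K23 * y)"
proof -
  have E: "\<beta> * \<delta> - \<alpha> * \<gamma> = 0"
    using relation by simp
  let ?E = "\<beta> * \<delta> - \<alpha> * \<gamma>"
  \<comment> \<open>This expansion is a polynomial identity in the structure constants. The
    off-diagonal part is a multiple of \<open>?E\<close>, which the relation \<alpha> \<gamma> =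
    \<beta> \<delta> makes 0.\<close>
  have "curvature_op A D (comb a b c) (comb a' b' c') (comb x y z) =
    comb ((a * c' - a' * c) * K13 * z - (a * b' - a' * b) * K12 * y
        + ?E * ((a * b' - a' * b) * z + (a * c' - a' * c) * y))
      ((a * b' - a' * b) * K12 * x + (b * c' - b' * c) * K23 * z - ?E * (a * c' - a' * c) * x)
      ((a * c' - a' * c) * K13 * x + (b * c' - b' * c) * K23 * y + ?E * (a * b' - a' * b) * x)"
    unfolding curvature_op_eq[OF comb_field comb_field comb_field] connection_comb_comb comb_diff
      K12_def K13_def K23_def
    by (rule arg_cong3[where f = comb]; simp add: field_simps power2_eq_square)
  then show ?thesis
    unfolding E by simp
qed

section \<open>The soliton equation in frame components\<close>

lemma lie_derivative_comb:
  "lie_derivative_metric A g (comb a b c) (comb x y z) (comb x' y' z') p =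
    (b * \<alpha> + c * \<gamma>) * (x * y' + x' * y) - (b * \<beta> + c * \<delta>) * (x * z' + x' * z)
    - 2 * a * \<alpha> * y * y' + a * (\<beta> - \<gamma>) * (y * z' + y' * z) + 2 * a * \<delta> * z * z'"
  unfolding lie_derivative_metric_eq[OF comb_field comb_field comb_field] connection_comb_comb
    metric_comb
  by (simp add: field_simps)

text \<open>The hypotheses are the vanishing of the off-diagonal components of the Lie derivative of
  the metric. Its Kulkarni-Nomizu product with the diagonal metric is then diagonal on bivectors,
  like the curvature. The planes containing \<open>e3\<close> carry a minus sign.\<close>

lemma soliton_defect_comb:
  "soliton_defect (comb a b c) lam (comb x y z) (comb x' y' z') (comb u v w) (comb u' v' w') p =
    (K12 - a * \<alpha> - lam) * (x * y' - x' * y) * (u' * v - u * v')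
    - (K13 - a * \<delta> - lam) * (x * z' - x' * z) * (u' * w - u * w')
    - (K23 - a * (\<alpha> + \<delta>) - lam) * (y * z' - y' * z) * (v' * w - v * w')"
  if "b * \<alpha> + c * \<gamma> = 0" "b * \<beta> + c * \<delta> = 0" "a * (\<beta> - \<gamma>) = 0"
  unfolding soliton_defect_def kulkarni_nomizu_def curvature_tensor_def curvature_comb
    lie_derivative_comb metric_comb that
  by (simp add: field_simps)

lemma soliton_iff:
  assumes "left_invariant_field A mul (comb a b c)"
  shows "left_invariant_riemann_soliton A mul g D (comb a b c) lam \<longleftrightarrow>
    b * \<alpha> + c * \<gamma> = 0 \<and> b * \<beta> + c * \<delta> = 0 \<and> a * (\<beta> - \<gamma>) = 0 \<and>
    lam = K12 - a * \<alpha> \<and> lam = K13 - a * \<delta> \<and> lam = K23 - a * (\<alpha> + \<delta>)"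
    (is "_ \<longleftrightarrow> ?eqs")
proof -
  have *: "left_invariant_riemann_soliton A mul g D (comb a b c) lam \<longleftrightarrow>
    (\<forall>X Y Z W p. vector_field A X \<longrightarrow> vector_field A Y \<longrightarrow> vector_field A Z \<longrightarrow> vector_field A W \<longrightarrow>
      soliton_defect (comb a b c) lam X Y Z W p = 0)"
    unfolding left_invariant_riemann_soliton_def soliton_defect_def using assms by simp
  show ?thesis
  proof
    assume "left_invariant_riemann_soliton A mul g D (comb a b c) lam"
    then have soliton: "soliton_defect (comb a b c) lam (comb x y z) (comb x' y' z') (comb u v w)
        (comb u' v' w') undefined = 0" for x y z x' y' z' u v w u' v' w'
      unfolding * by (simp add: comb_field)
    note unfold = soliton_defect_def kulkarni_nomizu_def curvature_tensor_def curvature_comb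
      lie_derivative_comb metric_comb
    \<comment> \<open>Inserting \<open>ei, ej, ej, ei\<close> isolates the equation of the plane
      spanned by \<open>ei\<close> and \<open>ej\<close>.\<close>
    have "lam = K12 - a * \<alpha>"
      using soliton[of 1 0 0 0 1 0 0 1 0 1 0 0] unfolding unfold by (simp add: field_simps)
    moreover have "lam = K13 - a * \<delta>"
      using soliton[of 1 0 0 0 0 1 0 0 1 1 0 0] unfolding unfold by (simp add: field_simps)
    moreover have "lam = K23 - a * (\<alpha> + \<delta>)"
      using soliton[of 0 1 0 0 0 1 0 0 1 0 1 0] unfolding unfold by (simp add: field_simps)
    \<comment> \<open>Inserting \<open>ei, ej, ej, ek\<close> with three different indices kills the
      curvature and the product of the metric with itself. Only the component of the Lie derivative
      at \<open>ei, ek\<close> remains, up to sign.\<close>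
    moreover have "b * \<alpha> + c * \<gamma> = 0"
      using soliton[of 1 0 0 0 0 1 0 0 1 0 1 0] unfolding unfold by simp
    moreover have "b * \<beta> + c * \<delta> = 0"
      using soliton[of 1 0 0 0 1 0 0 1 0 0 0 1] unfolding unfold by simp
    moreover have "a * (\<beta> - \<gamma>) = 0"
      using soliton[of 0 1 0 1 0 0 1 0 0 0 0 1] unfolding unfold by simp
    ultimately show ?eqs by blast
  next
    assume eqs: ?eqs
    then have "K12 - a * \<alpha> - lam = 0" "K13 - a * \<delta> - lam = 0" "K23 - a * (\<alpha> + \<delta>) - lam = 0"
      by linarith+
    with eqs have zero: "soliton_defect (comb a b c) lam (comb x y z) (comb x' y' z')
        (comb u v w) (comb u' v' w') p = 0" for x y z x' y' z' u v w u' v' w' p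
      by (subst soliton_defect_comb) simp_all
    have "soliton_defect (comb a b c) lam X Y Z W p = 0"
      if "X \<in> {e1, e2, e3}" "Y \<in> {e1, e2, e3}" "Z \<in> {e1, e2, e3}" "W \<in> {e1, e2, e3}" for X Y Z W p
    proof -
      have "\<exists>x y z. E = comb x y z" if "E \<in> {e1, e2, e3}" for E
        using that frame_eq_comb by blast
      with that obtain x y z x' y' z' u v w u' v' w'
        where "X = comb x y z" "Y = comb x' y' z'" "Z = comb u v w" "W = comb u' v' w'"
        by metis
      then show ?thesis
        using zero by simp
    qed
    then show "left_invariant_riemann_soliton A mul g D (comb a b c) lam"
      unfolding * by (blast intro: soliton_defect_eq_0[OF comb_field])
  qed
qed

end


section \<open>Solving the six equations by cases\<close>

lemma g6_soliton_equations:
  fixes \<alpha> \<beta> \<gamma> \<delta> lam l1 l2 l3 :: real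
  assumes sum: "\<alpha> + \<delta> \<noteq> 0" and rel: "\<alpha> * \<gamma> = \<beta> * \<delta>"
  shows "l2 * \<alpha> + l3 * \<gamma> = 0 \<and> l2 * \<beta> + l3 * \<delta> = 0 \<and> l1 * (\<beta> - \<gamma>) = 0 \<and>
      lam = \<alpha>\<^sup>2 - (\<beta> - \<gamma>) * (3 * \<beta> + \<gamma>) / 4 - l1 * \<alpha> \<and>
      lam = \<delta>\<^sup>2 + (\<beta> - \<gamma>) * (\<beta> + 3 * \<gamma>) / 4 - l1 * \<delta> \<and>
      lam = \<alpha> * \<delta> + (\<beta> - \<gamma>)\<^sup>2 / 4 - l1 * (\<alpha> + \<delta>) \<longleftrightarrow>
    (\<beta> \<noteq> \<gamma> \<and> l1 = 0 \<and> \<alpha> = 0 \<and> \<beta> = 0 \<and> lam = \<gamma>^2 / 4 \<and> l3 = 0 \<and> \<delta>^2 = \<gamma>^2) \<or>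
     (\<beta> \<noteq> \<gamma> \<and> l1 = 0 \<and> \<alpha> \<noteq> 0 \<and> \<alpha>^2 = \<beta>^2 \<and> \<delta> = \<beta> * \<gamma> / \<alpha> \<and> lam = (\<beta> + \<gamma>)^2 / 4 \<and>
        l2 = - (\<gamma> / \<alpha>) * l3) \<or>
     (\<beta> = \<gamma> \<and> \<beta> \<noteq> 0 \<and> \<alpha> = \<delta> \<and> \<alpha> \<noteq> 0 \<and> l1 = 0 \<and> l2 = 0 \<and> l3 = 0 \<and> lam = \<alpha>^2) \<or>
     (l3 \<noteq> 0 \<and> l2 = - (\<delta> / \<beta>) * l3 \<and> \<alpha> \<noteq> 0 \<and> \<beta> \<noteq> 0 \<and> \<beta> = \<gamma> \<and> \<alpha> = \<delta> \<and> \<alpha>^2 = \<beta>^2 \<and>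
        l1 = 0 \<and> lam = \<alpha>^2) \<or>
     (\<beta> = 0 \<and> \<gamma> = 0 \<and> \<alpha> \<noteq> 0 \<and> \<delta> \<noteq> 0 \<and> l1 = 0 \<and> l2 = 0 \<and> l3 = 0 \<and> \<alpha> = \<delta> \<and> lam = \<alpha>^2)"
    (is "?eqs \<longleftrightarrow> ?i \<or> ?ii \<or> ?iii \<or> ?iv \<or> ?v")
proof
  assume eqs: ?eqs
  note L = eqs[THEN conjunct1] eqs[THEN conjunct2, THEN conjunct1]
    eqs[THEN conjunct2, THEN conjunct2, THEN conjunct1]
  have lam: "lam = \<alpha>\<^sup>2 - (\<beta> - \<gamma>) * (3 * \<beta> + \<gamma>) / 4 - l1 * \<alpha>"
    "lam = \<delta>\<^sup>2 + (\<beta> - \<gamma>) * (\<beta> + 3 * \<gamma>) / 4 - l1 * \<delta>"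
    "lam = \<alpha> * \<delta> + (\<beta> - \<gamma>)\<^sup>2 / 4 - l1 * (\<alpha> + \<delta>)"
    using eqs by blast+
  show "?i \<or> ?ii \<or> ?iii \<or> ?iv \<or> ?v"
  proof (cases "\<beta> = \<gamma>")
    case False
    then have "l1 = 0"
      using L by simp
    \<comment> \<open>Subtract the first two equations for \<open>lam\<close>; the curvature terms
      add up because \<open>(3 * \<beta> + \<gamma>) + (\<beta> + 3 * \<gamma>) = 4 * (\<beta> +
      \<gamma>)\<close>.\<close>
    have sq: "\<alpha>\<^sup>2 - \<delta>\<^sup>2 = \<beta>\<^sup>2 - \<gamma>\<^sup>2"
      using lam(1,2) unfolding \<open>l1 = 0\<close> by (simp add: field_simps power2_eq_square)
    show ?thesis
    proof (cases "\<alpha> = 0")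
      case True
      then have "\<delta> \<noteq> 0" "\<beta> = 0"
        using sum rel by auto
      then have ?i
        using True False \<open>l1 = 0\<close> L lam(1) sq by (simp add: power2_eq_square)
      then show ?thesis by blast
    next
      case \<alpha>: False
      \<comment> \<open>Multiply \<open>sq\<close> by \<open>\<alpha>\<^sup>2\<close> and replace
        \<alpha> \<gamma> by \<beta> \<delta>: the right-hand side becomes
        \<open>\<beta>\<^sup>2 * (\<alpha>\<^sup>2 - \<delta>\<^sup>2)\<close>.\<close>
      have "(\<alpha>\<^sup>2 - \<beta>\<^sup>2) * ((\<alpha> - \<delta>) * (\<alpha> + \<delta>)) = 0"
        using sq rel by algebra
      moreover have "\<alpha> \<noteq> \<delta>"
        using rel False \<alpha> by auto
      ultimately have sq': "\<alpha>\<^sup>2 = \<beta>\<^sup>2"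
        using sum by simp
      then have "\<beta> = \<alpha> \<or> \<beta> = - \<alpha>"
        by (auto simp: power2_eq_iff)
      then have "\<delta> = \<beta> * \<gamma> / \<alpha>"
      proof
        assume "\<beta> = \<alpha>"
        then show ?thesis using rel \<alpha> by simp
      next
        assume "\<beta> = - \<alpha>"
        then have "\<alpha> * (\<gamma> + \<delta>) = 0" using rel by (simp add: algebra_simps)
        then show ?thesis using \<alpha> \<open>\<beta> = - \<alpha>\<close> by simp
      qed
      moreover have "l2 = - (\<gamma> / \<alpha>) * l3"
        using L \<alpha> by (simp add: field_simps)
      moreover have "lam = (\<beta> + \<gamma>)\<^sup>2 / 4"
        using lam(1) sq' \<open>l1 = 0\<close> by (simp add: field_simps power2_eq_square)
      ultimately show ?thesis
        using False \<alpha> \<open>l1 = 0\<close> sq' by blast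
    qed
  next
    case True
    then have eq: "lam = \<alpha>\<^sup>2 - l1 * \<alpha>" "lam = \<delta>\<^sup>2 - l1 * \<delta>" "lam = \<alpha> * \<delta> - l1 * (\<alpha> + \<delta>)"
      using lam by simp_all
    have "\<alpha> = \<delta>"
    proof (rule ccontr)
      assume ne: "\<alpha> \<noteq> \<delta>"
      \<comment> \<open>The difference of the first two equations. The resulting value of
        \<open>l1\<close> turns the first into \<open>lam = - \<alpha> * \<delta>\<close>, and
        comparison with the third leaves a vanishing sum of squares.\<close>
      have "(\<alpha> - \<delta>) * (\<alpha> + \<delta> - l1) = 0"
        using eq(1,2) by (simp add: algebra_simps power2_eq_square)
      then have "l1 = \<alpha> + \<delta>"
        using ne by simp
      then have "\<alpha>\<^sup>2 + \<delta>\<^sup>2 = 0"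
        using eq(1,3) by algebra
      then show False
        using sum by (simp add: sum_power2_eq_zero_iff)
    qed
    then have "\<alpha> \<noteq> 0"
      using sum by simp
    then have "l1 = 0"
      using eq(1,3) \<open>\<alpha> = \<delta>\<close> by (simp add: power2_eq_square)
    have lam': "lam = \<alpha>\<^sup>2"
      using eq(1) \<open>l1 = 0\<close> by simp
    note facts = True \<open>\<alpha> = \<delta>\<close> \<open>\<alpha> \<noteq> 0\<close> \<open>l1 = 0\<close> lam'
    have L': "l2 * \<alpha> = - l3 * \<beta>" "l2 * \<beta> = - l3 * \<alpha>"
      using L True \<open>\<alpha> = \<delta>\<close> by simp_all
    show ?thesis
    \<comment> \<open>\<beta> = 0 gives \<open>?v\<close>; otherwise \<open>?iii\<close> or
      \<open>?iv\<close> holds, according to whether \<open>l3\<close> vanishes.\<close>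
    proof (cases "\<beta> = 0")
      case True
      then show ?thesis using facts L' by simp
    next
      case \<beta>: False
      show ?thesis
      proof (cases "l3 = 0")
        case True
        then show ?thesis using facts L' \<beta> by simp
      next
        case False
        \<comment> \<open>Both sides equal \<open>- l2 * \<alpha> * \<beta>\<close> by the two
          equations in \<open>L'\<close>.\<close>
        have "l3 * \<alpha>\<^sup>2 = l3 * \<beta>\<^sup>2"
          using L' by algebra
        then have "\<alpha>\<^sup>2 = \<beta>\<^sup>2"
          using False by simp
        moreover have "l2 = - (\<delta> / \<beta>) * l3"
          using L'(2) \<beta> \<open>\<alpha> = \<delta>\<close> by (simp add: field_simps)
        ultimately show ?thesis
          using facts \<beta> False by blast
      qed
    qed
  qed
next
  assume "?i \<or> ?ii \<or> ?iii \<or> ?iv \<or> ?v"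
  then show ?eqs
  proof (elim disjE)
    assume i: ?i
    then have "\<delta> * \<delta> = \<gamma> * \<gamma>"
      by (simp add: power2_eq_square)
    with i show ?thesis by (simp add: power2_eq_square)
  next
    assume ii: ?ii
    then have l: "l1 = 0" "l2 * \<alpha> = - (l3 * \<gamma>)" and lam: "lam = (\<beta> + \<gamma>)\<^sup>2 / 4"
      by simp_all
    \<comment> \<open>Fixing the sign of \<beta> relative to \<alpha> removes the quotient in
      \<delta>, and all equations become polynomial.\<close>
    have "\<beta> = \<alpha> \<and> \<delta> = \<gamma> \<or> \<beta> = - \<alpha> \<and> \<delta> = - \<gamma>"
      using ii by (auto simp: power2_eq_iff)
    then show ?thesis
    proof (elim disjE conjE)
      assume "\<beta> = \<alpha>" "\<delta> = \<gamma>"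
      then show ?thesis
        unfolding lam by (simp add: l) (simp add: field_simps power2_eq_square)
    next
      assume "\<beta> = - \<alpha>" "\<delta> = - \<gamma>"
      then show ?thesis
        unfolding lam by (simp add: l) (simp add: field_simps power2_eq_square)
    qed
  next
    assume iii: ?iii
    then show ?thesis by (simp add: power2_eq_square)
  next
    assume iv: ?iv
    then have l: "l1 = 0" "\<delta> = \<alpha>" "\<gamma> = \<beta>" "lam = \<alpha>\<^sup>2" and "l2 * \<beta> = - (l3 * \<alpha>)"
      by simp_all
    moreover have "\<beta> = \<alpha> \<or> \<beta> = - \<alpha>"
      using iv by (auto simp: power2_eq_iff)
    then have "l2 * \<alpha> = - (l3 * \<beta>)"
      using \<open>l2 * \<beta> = - (l3 * \<alpha>)\<close> by auto
    ultimately show ?thesis by (simp add: power2_eq_square)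
  next
    assume v: ?v
    then show ?thesis by (simp add: power2_eq_square)
  qed
qed

theorem theorem2p6:
  fixes A :: "('g::{t2_space, second_countable_topology}, real^3) atlas"
    and mul :: "'g \<Rightarrow> 'g \<Rightarrow> 'g" and e :: 'g and ginv :: "'g \<Rightarrow> 'g"
    and g :: "'g metric" and D :: "'g connection"
    and e1 e2 e3 :: "'g vfield"
    and \<alpha> \<beta> \<gamma> \<delta> lam l1 l2 l3 :: real
  assumes "\<alpha> + \<delta> \<noteq> 0" and "\<alpha> * \<gamma> - \<beta> * \<delta> = 0"
    and "lie_group A mul e ginv"
    and "connected (UNIV :: 'g set)" and "simply_connected (UNIV :: 'g set)"
    and "lorentzian_metric A g" and "left_invariant_metric A mul g"
    and "levi_civita A g D"
    and "lie_algebra_basis3 A mul e1 e2 e3" and "pseudo_orthonormal3 g e1 e2 e3"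
    and "lie_bracket A e1 e2 = \<alpha> *\<^sub>V e2 + \<beta> *\<^sub>V e3"
    and "lie_bracket A e1 e3 = \<gamma> *\<^sub>V e2 + \<delta> *\<^sub>V e3"
    and "lie_bracket A e2 e3 = 0"
  shows "left_invariant_riemann_soliton A mul g D (l1 *\<^sub>V e1 + l2 *\<^sub>V e2 + l3 *\<^sub>V e3) lam \<longleftrightarrow>
     (\<beta> \<noteq> \<gamma> \<and> l1 = 0 \<and> \<alpha> = 0 \<and> \<beta> = 0 \<and> lam = \<gamma>^2 / 4 \<and> l3 = 0 \<and> \<delta>^2 = \<gamma>^2) \<or>
     (\<beta> \<noteq> \<gamma> \<and> l1 = 0 \<and> \<alpha> \<noteq> 0 \<and> \<alpha>^2 = \<beta>^2 \<and> \<delta> = \<beta> * \<gamma> / \<alpha> \<and> lam = (\<beta> + \<gamma>)^2 / 4 \<and>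
        l2 = - (\<gamma> / \<alpha>) * l3) \<or>
     (\<beta> = \<gamma> \<and> \<beta> \<noteq> 0 \<and> \<alpha> = \<delta> \<and> \<alpha> \<noteq> 0 \<and> l1 = 0 \<and> l2 = 0 \<and> l3 = 0 \<and> lam = \<alpha>^2) \<or>
     (l3 \<noteq> 0 \<and> l2 = - (\<delta> / \<beta>) * l3 \<and> \<alpha> \<noteq> 0 \<and> \<beta> \<noteq> 0 \<and> \<beta> = \<gamma> \<and> \<alpha> = \<delta> \<and> \<alpha>^2 = \<beta>^2 \<and>
        l1 = 0 \<and> lam = \<alpha>^2) \<or>
     (\<beta> = 0 \<and> \<gamma> = 0 \<and> \<alpha> \<noteq> 0 \<and> \<delta> \<noteq> 0 \<and> l1 = 0 \<and> l2 = 0 \<and> l3 = 0 \<and> \<alpha> = \<delta> \<and> lam = \<alpha>^2)"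
proof -
  note basis = \<open>lie_algebra_basis3 A mul e1 e2 e3\<close>[unfolded lie_algebra_basis3_def]
  \<comment> \<open>The atlas is smooth as part of the Lie group structure, and the frame fields are
    smooth as part of left invariance.\<close>
  interpret lorentzian_g6 A g D e1 e2 e3 \<alpha> \<beta> \<gamma> \<delta>
    using assms basis by unfold_locales (auto simp: lie_group_def left_invariant_field_def)
  have "left_invariant_field A mul (comb l1 l2 l3)"
    using basis by (intro left_invariant_comb) auto
  moreover have "\<alpha> * \<gamma> = \<beta> * \<delta>"
    using assms(2) by simp
  \<comment> \<open>Unfolding \<open>K12\<close>, \<open>K13\<close> and \<open>K23\<close> turns
    the right-hand side of \<open>soliton_iff\<close> into the system solved in
    \<open>g6_soliton_equations\<close>.\<close>
  ultimately show ?thesis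
    using soliton_iff[of mul l1 l2 l3 lam] g6_soliton_equations[OF assms(1), of \<gamma> \<beta> l2 l3 l1 lam]
    unfolding comb_def K12_def K13_def K23_def by simp
qed

end
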